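(* Let $E$ be a quasi-Banach ideal space with the Fatou property over $(T,\Sigma,\mu)$ and let $\varphi$ be an Orlicz function with $a_\varphi<b_\varphi$ and $\alpha^E_\varphi>0$. Let $\mu$ be nonatomic. Then $E_\varphi$ contains an order isomorphic copy of $l_\infty$ if and only if $E$ contains an order isomorphic copy of $l_\infty$ or $\varphi\notin\Delta_2^E$.
   Context: $(T,\Sigma,\mu)$ is a complete $\sigma$-finite measure space with $\mu(T)>0$; $L^0$ is the space of ($\mu$-a.e. classes of) real $\Sigma$-measurable functions on $T$, with the a.e. order; $L_\infty=L_\infty(T,\Sigma,\mu)$. A quasi-norm is a functional satisfying the axioms of a norm with the triangle inequality replaced by $\|x+y\|\le C(\|x\|+\|y\|)$ for some constant $C\ge1$. A quasi-Banach ideal space is a linear subspace $E\subset L^0$ with a complete quasi-norm $\|\cdot\|_E$ such that (i) $x\in L^0$, $y\in E$, $|x|\le|y|$ a.e. imply $x\in E$, $\|x\|_E\le\|y\|_E$; (ii) some $x\in E$ is strictly positive on $T$. $E$ has the Fatou property if $0\le x_n\uparrow|x|$ a.e., $x_n\in E$, $x\in L^0$, $\sup_n\|x_n\|_E<\infty$ imply $x\in E$ and $\|x_n\|_E\to\|x\|_E$. An Orlicz function is a non-decreasing $\varphi:[0,\infty)\to[0,\infty]$ with $\varphi(0)=0$, right continuous at $0$, continuous on $(0,b_\varphi)$ and left continuous at $b_\varphi$, where $b_\varphi=\sup\{u\ge0:\varphi(u)<\infty\}$, and with $\lim_{u\to\infty}\varphi(u)=\infty$. $a_\varphi=\sup\{u\ge0:\varphi(u)=0\}$.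 $\varphi\in\Delta_2(\mathbb R_+)$: there is $K>0$ with $\varphi(2u)\le K\varphi(u)$ for all $u\ge0$. $\varphi\in\Delta_2(\infty)$ [$\Delta_2(0)$]: there are $K,u_0\in(0,\infty)$ with $\varphi(u_0)<\infty$ [$\varphi(u_0)>0$] and $\varphi(2u)\le K\varphi(u)$ for all $u\ge u_0$ [$0\le u\le u_0$]. $\varphi\in\Delta_2^E$ means $\varphi\in\Delta_2(\mathbb R_+)$ if neither $L_\infty\subset E$ nor $E\subset L_\infty$; $\varphi\in\Delta_2(\infty)$ if $L_\infty\subset E$; $\varphi\in\Delta_2(0)$ if $E\subset L_\infty$. Indices: $\alpha^a_\varphi$ is the supremum of $p\in\mathbb R$ for which there is $K\ge1$ with $\varphi(au)\le Ka^p\varphi(u)$ for all $u\ge0$, $0<a\le1$; $\alpha^\infty_\varphi$ is the same with the inequality required only for $u\ge u_0$, for some $u_0>0$ with $\varphi(u_0)<\infty$; $\alpha^0_\varphi$ is the same with the inequality required only for $0\le u\le u_0$, for some $u_0>0$. $\alpha^E_\varphi=\alpha^a_\varphi$ if neither $L_\infty\subset E$ nor $E\subset L_\infty$; $\alpha^E_\varphi=\alpha^\infty_\varphi$ if $L_\infty\subset E$; $\alpha^E_\varphi=\alpha^0_\varphi$ if $E\subset L_\infty$. (If $E=L_\infty$ as sets, the last two clauses in these case distinctions overlap and either may be used.) $\rho^E_\varphi(x)=\|\varphi(|x|)\|_E$ if $\varphi(|x|)\in E$, and $=\infty$ otherwise; $E_\varphi=\{x\in L^0:\rho^E_\varphi(\lambda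 x)<\infty\text{ for some }\lambda>0\}$ with the quasi-norm $\|x\|_\varphi=\inf\{\lambda>0:\rho^E_\varphi(x/\lambda)\le1\}$. A quasi-Banach ideal space $F$ contains an order isomorphic copy of $l_\infty$ if there are a linear map $P:l_\infty\to F$ and constants $c,C>0$ with $|Pz|=P|z|$ and $c\|z\|_{l_\infty}\le\|Pz\|_F\le C\|z\|_{l_\infty}$ for all $z\in l_\infty$. *)

theory Defs
  imports "HOL-Analysis.Analysis"
begin

text \<open>
  Elements of \<open>L\<^sup>0\<close> are represented by measurable functions \<open>'a \<Rightarrow> real\<close>; equality and order are
  taken almost everywhere.  A space is a pair of a set \<open>E\<close> of such functions and a functional
  \<open>N\<close>, of which only the values on \<open>E\<close> matter.  The ideal property makes both invariant under
  a.e. equality, so that they descend to classes.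
\<close>

definition quasi_norm_on :: "'a measure \<Rightarrow> ('a \<Rightarrow> real) set \<Rightarrow> (('a \<Rightarrow> real) \<Rightarrow> real) \<Rightarrow> bool" where
  "quasi_norm_on M E N \<longleftrightarrow>
     (\<forall>x\<in>E. 0 \<le> N x) \<and>
     (\<forall>x\<in>E. N x = 0 \<longleftrightarrow> (AE t in M. x t = 0)) \<and>
     (\<forall>x\<in>E. \<forall>c. N (\<lambda>t. c * x t) = \<bar>c\<bar> * N x) \<and>
     (\<exists>C\<ge>1. \<forall>x\<in>E. \<forall>y\<in>E. N (\<lambda>t. x t + y t) \<le> C * (N x + N y))"

definition complete_quasi_norm_on :: "('a \<Rightarrow> real) set \<Rightarrow> (('a \<Rightarrow> real) \<Rightarrow> real) \<Rightarrow> bool" where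
  "complete_quasi_norm_on E N \<longleftrightarrow>
     (\<forall>X :: nat \<Rightarrow> 'a \<Rightarrow> real.
        (\<forall>n. X n \<in> E) \<and> (\<forall>e>0. \<exists>k. \<forall>m\<ge>k. \<forall>n\<ge>k. N (\<lambda>t. X m t - X n t) < e) \<longrightarrow>
        (\<exists>x\<in>E. (\<lambda>n. N (\<lambda>t. X n t - x t)) \<longlonglongrightarrow> 0))"

definition quasi_banach_ideal_space ::
    "'a measure \<Rightarrow> ('a \<Rightarrow> real) set \<Rightarrow> (('a \<Rightarrow> real) \<Rightarrow> real) \<Rightarrow> bool" where
  "quasi_banach_ideal_space M E N \<longleftrightarrow>
     E \<subseteq> borel_measurable M \<and>
     (\<lambda>t. 0) \<in> E \<and>
     (\<forall>x\<in>E. \<forall>y\<in>E. (\<lambda>t. x t + y t) \<in> E) \<and>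
     (\<forall>x\<in>E. \<forall>c. (\<lambda>t. c * x t) \<in> E) \<and>
     quasi_norm_on M E N \<and>
     complete_quasi_norm_on E N \<and>
     (\<forall>x\<in>borel_measurable M. \<forall>y\<in>E. (AE t in M. \<bar>x t\<bar> \<le> \<bar>y t\<bar>) \<longrightarrow> x \<in> E \<and> N x \<le> N y) \<and>
     (\<exists>x\<in>E. AE t in M. 0 < x t)"

definition fatou_property ::
    "'a measure \<Rightarrow> ('a \<Rightarrow> real) set \<Rightarrow> (('a \<Rightarrow> real) \<Rightarrow> real) \<Rightarrow> bool" where
  "fatou_property M E N \<longleftrightarrow>
     (\<forall>(X :: nat \<Rightarrow> 'a \<Rightarrow> real) x.
        (\<forall>n. X n \<in> E) \<and> x \<in> borel_measurable M \<and>
        (AE t in M. (\<forall>n. 0 \<le> X n t) \<and> incseq (\<lambda>n. X n t) \<and> (\<lambda>n. X n t) \<longlonglongrightarrow> \<bar>x t\<bar>) \<and>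
        bdd_above (range (\<lambda>n. N (X n))) \<longrightarrow>
        x \<in> E \<and> (\<lambda>n. N (X n)) \<longlonglongrightarrow> N x)"

definition L_infinity :: "'a measure \<Rightarrow> ('a \<Rightarrow> real) set" where
  "L_infinity M = {x \<in> borel_measurable M. \<exists>C. AE t in M. \<bar>x t\<bar> \<le> C}"

text \<open>An atom is a set of positive measure that is not the union of two disjoint measurable
  sets of positive measure.\<close>

definition nonatomic :: "'a measure \<Rightarrow> bool" where
  "nonatomic M \<longleftrightarrow>
     \<not> (\<exists>A\<in>sets M. emeasure M A > 0 \<and>
          (\<forall>B\<in>sets M. B \<subseteq> A \<longrightarrow> emeasure M B = 0 \<or> emeasure M (A - B) = 0))"


text \<open>Orlicz functions are only ever evaluated on \<open>{0..}\<close>; their values at negative reals are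
  irrelevant.\<close>

definition a_orlicz :: "(real \<Rightarrow> ennreal) \<Rightarrow> ereal" where
  "a_orlicz \<phi> = (SUP u\<in>{u. 0 \<le> u \<and> \<phi> u = 0}. ereal u)"

definition b_orlicz :: "(real \<Rightarrow> ennreal) \<Rightarrow> ereal" where
  "b_orlicz \<phi> = (SUP u\<in>{u. 0 \<le> u \<and> \<phi> u < \<infinity>}. ereal u)"

text \<open>If \<open>b_orlicz \<phi> = \<infinity>\<close>, left continuity at that point is subsumed by the last conjunct.\<close>

definition orlicz_function :: "(real \<Rightarrow> ennreal) \<Rightarrow> bool" where
  "orlicz_function \<phi> \<longleftrightarrow>
     mono_on {0..} \<phi> \<and>
     \<phi> 0 = 0 \<and>
     continuous (at_right 0) \<phi> \<and>
     continuous_on {u. 0 < u \<and> ereal u < b_orlicz \<phi>} \<phi> \<and>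
     (\<forall>b. b_orlicz \<phi> = ereal b \<longrightarrow> continuous (at_left b) \<phi>) \<and>
     (\<phi> \<longlongrightarrow> \<infinity>) at_top"

text \<open>
  The growth condition \<open>\<Delta>\<^sub>2\<close> and the lower index come in three variants, selected by the position
  of \<open>E\<close> relative to \<open>L\<^sub>\<infinity>\<close>.  If \<open>E = L\<^sub>\<infinity>\<close> as sets, two variants are applicable and either may be
  used; hence the selection is a relation, and statements quantify over all applicable variants.
\<close>

datatype variant = Everywhere | At_Infinity | At_Zero

definition applicable :: "'a measure \<Rightarrow> ('a \<Rightarrow> real) set \<Rightarrow> variant \<Rightarrow> bool" where
  "applicable M E v \<longleftrightarrow>
     (case v of
        Everywhere \<Rightarrow> \<not> L_infinity M \<subseteq> E \<and> \<not> E \<subseteq> L_infinity M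
      | At_Infinity \<Rightarrow> L_infinity M \<subseteq> E
      | At_Zero \<Rightarrow> E \<subseteq> L_infinity M)"

definition Delta2 :: "variant \<Rightarrow> (real \<Rightarrow> ennreal) \<Rightarrow> bool" where
  "Delta2 v \<phi> \<longleftrightarrow>
     (case v of
        Everywhere \<Rightarrow> \<exists>K>0. \<forall>u\<ge>0. \<phi> (2 * u) \<le> ennreal K * \<phi> u
      | At_Infinity \<Rightarrow> \<exists>K>0. \<exists>u0>0. \<phi> u0 < \<infinity> \<and> (\<forall>u\<ge>u0. \<phi> (2 * u) \<le> ennreal K * \<phi> u)
      | At_Zero \<Rightarrow> \<exists>K>0. \<exists>u0>0. \<phi> u0 > 0 \<and> (\<forall>u\<in>{0..u0}. \<phi> (2 * u) \<le> ennreal K * \<phi> u))"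

definition lower_power_bound :: "(real \<Rightarrow> ennreal) \<Rightarrow> real set \<Rightarrow> real \<Rightarrow> bool" where
  "lower_power_bound \<phi> U p \<longleftrightarrow>
     (\<exists>K\<ge>1. \<forall>u\<in>U. \<forall>a\<in>{0<..1}. \<phi> (a * u) \<le> ennreal (K * a powr p) * \<phi> u)"

text \<open>The supremum is taken in the extended reals; it can be \<open>\<infinity>\<close>, e.g. the index at zero
  if \<open>a_orlicz \<phi> > 0\<close>.\<close>

definition lower_index :: "variant \<Rightarrow> (real \<Rightarrow> ennreal) \<Rightarrow> ereal" where
  "lower_index v \<phi> =
     (SUP p \<in> (case v of
        Everywhere \<Rightarrow> {p. lower_power_bound \<phi> {0..} p}
      | At_Infinity \<Rightarrow> {p. \<exists>u0>0. \<phi> u0 < \<infinity> \<and> lower_power_bound \<phi> {u0..} p}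
      | At_Zero \<Rightarrow> {p. \<exists>u0>0. lower_power_bound \<phi> {0..u0} p}). ereal p)"

text \<open>Membership of \<open>\<phi>(|x|)\<close> in \<open>E\<close> includes its finiteness a.e., as elements of \<open>L\<^sup>0\<close> are
  real valued.\<close>

definition orlicz_modular ::
    "'a measure \<Rightarrow> ('a \<Rightarrow> real) set \<Rightarrow> (('a \<Rightarrow> real) \<Rightarrow> real) \<Rightarrow> (real \<Rightarrow> ennreal) \<Rightarrow>
     ('a \<Rightarrow> real) \<Rightarrow> ennreal" where
  "orlicz_modular M E N \<phi> x =
     (if (AE t in M. \<phi> \<bar>x t\<bar> < \<infinity>) \<and> (\<lambda>t. enn2real (\<phi> \<bar>x t\<bar>)) \<in> E
      then ennreal (N (\<lambda>t. enn2real (\<phi> \<bar>x t\<bar>))) else \<infinity>)"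

definition orlicz_space ::
    "'a measure \<Rightarrow> ('a \<Rightarrow> real) set \<Rightarrow> (('a \<Rightarrow> real) \<Rightarrow> real) \<Rightarrow> (real \<Rightarrow> ennreal) \<Rightarrow>
     ('a \<Rightarrow> real) set" where
  "orlicz_space M E N \<phi> =
     {x \<in> borel_measurable M. \<exists>l>0. orlicz_modular M E N \<phi> (\<lambda>t. l * x t) < \<infinity>}"

definition orlicz_norm ::
    "'a measure \<Rightarrow> ('a \<Rightarrow> real) set \<Rightarrow> (('a \<Rightarrow> real) \<Rightarrow> real) \<Rightarrow> (real \<Rightarrow> ennreal) \<Rightarrow>
     ('a \<Rightarrow> real) \<Rightarrow> real" where
  "orlicz_norm M E N \<phi> x = Inf {l. 0 < l \<and> orlicz_modular M E N \<phi> (\<lambda>t. x t / l) \<le> 1}"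


definition l_infinity :: "(nat \<Rightarrow> real) set" where
  "l_infinity = {z. bounded (range z)}"

definition l_infinity_norm :: "(nat \<Rightarrow> real) \<Rightarrow> real" where
  "l_infinity_norm z = (SUP n. \<bar>z n\<bar>)"

definition contains_order_copy_l_infinity ::
    "'a measure \<Rightarrow> ('a \<Rightarrow> real) set \<Rightarrow> (('a \<Rightarrow> real) \<Rightarrow> real) \<Rightarrow> bool" where
  "contains_order_copy_l_infinity M F N \<longleftrightarrow>
     (\<exists>(P :: (nat \<Rightarrow> real) \<Rightarrow> 'a \<Rightarrow> real) c C. 0 < c \<and> 0 < C \<and>
        (\<forall>z\<in>l_infinity. P z \<in> F) \<and>
        (\<forall>z\<in>l_infinity. \<forall>w\<in>l_infinity. AE t in M. P (\<lambda>n. z n + w n) t = P z t + P w t) \<and>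
        (\<forall>z\<in>l_infinity. \<forall>r. AE t in M. P (\<lambda>n. r * z n) t = r * P z t) \<and>
        (\<forall>z\<in>l_infinity. AE t in M. \<bar>P z t\<bar> = P (\<lambda>n. \<bar>z n\<bar>) t) \<and>
        (\<forall>z\<in>l_infinity. c * l_infinity_norm z \<le> N (P z) \<and> N (P z) \<le> C * l_infinity_norm z))"

end

theory Submission
  imports Defs
begin

text \<open>
  A space whose functional is homogeneous and monotone contains an order copy of \<open>l\<^sub>\<infinity>\<close> exactly when
  it contains a disjoint sequence that is order bounded but stays away from zero in norm
  (\<open>copy_imp_disjoint_sequence\<close>, \<open>disjoint_sequence_imp_copy\<close>).  The question thus becomes how such
  sequences travel between \<open>E\<close> and \<open>E\<^sub>\<phi>\<close>.  The positive index enters only through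
  \<open>modular_shrinks\<close>: scaling by a small constant makes the modular small, uniformly on
  modular-bounded sets.  This makes \<open>E\<^sub>\<phi>\<close> an ideal with a homogeneous monotone functional, and it
  turns a lower bound for the modular of \<open>y\<close> into a lower bound for the quasi-norm of \<open>y\<close>.

  Suppose that \<open>E\<^sub>\<phi>\<close> has such a sequence \<open>X\<close> below \<open>x\<close> and that \<open>\<Delta>\<^sub>2\<close> holds everywhere, or
  at infinity when \<open>E\<close> contains the bounded functions.  Then the modular of \<open>x / d\<close> is finite for every \<open>d > 0\<close>, and for small \<open>d\<close> the functions \<open>\<phi>(X n / d)\<close> have norm
  above 1 in \<open>E\<close> while they stay below \<open>\<phi>(x / d)\<close> (\<open>Delta2_copy_descends\<close>).

  For the converse there are three sources of a copy.  If \<open>\<phi>\<close> takes the value \<open>\<infinity>\<close>, with jump point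
  \<open>b\<close>, the functions \<open>b\<close> on disjoint sets of positive measure serve, because any dilation has
  infinite modular (\<open>copy_of_finite_threshold\<close>).  If \<open>\<phi>\<close> is finite and \<open>E\<close> has a copy, that copy is
  lifted through a right inverse of \<open>\<phi>\<close> (\<open>copy_lifts\<close>).  If \<open>\<phi>\<close> is finite, \<open>\<Delta>\<^sub>2\<close> fails and \<open>E\<close>
  has no copy, then by the Fatou property the norms of the indicators of sets decreasing to the empty
  set, inside a set with indicator in \<open>E\<close>, tend to zero, and nonatomicity provides indicators of any
  prescribed small norm, up to the constant of the quasi-triangle inequality
  (\<open>indicator_with_prescribed_norm\<close>).  Choose \<open>u n\<close> where
  doubling fails by a huge factor, and disjoint sets \<open>A n\<close> for which the norm of \<open>\<phi>(u n)\<close> on \<open>A n\<close>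
  is tiny and that of \<open>\<phi>(2 * u n)\<close> exceeds 1: the step functions \<open>u n\<close> on \<open>A n\<close> span the copy
  (\<open>copy_of_doubling_failure\<close>).

  If \<open>E\<close> consists of bounded functions, its norm dominates the supremum norm, so nonatomicity alone
  gives a copy in \<open>E\<close> (\<open>subspace_of_L_infinity_copy\<close>) and both sides of the equivalence hold.  This
  settles the situation where the index and \<open>\<Delta>\<^sub>2\<close> are taken in different variants.
\<close>

section \<open>Order copies of \<open>l\<^sub>\<infinity>\<close> as disjoint sequences\<close>

definition ideal_functional ::
    "'a measure \<Rightarrow> ('a \<Rightarrow> real) set \<Rightarrow> (('a \<Rightarrow> real) \<Rightarrow> real) \<Rightarrow> bool" where
  "ideal_functional M F G \<longleftrightarrow>
     F \<subseteq> borel_measurable M \<and>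
     (\<forall>x\<in>F. \<forall>c. (\<lambda>t. c * x t) \<in> F \<and> G (\<lambda>t. c * x t) = \<bar>c\<bar> * G x) \<and>
     (\<forall>x\<in>borel_measurable M. \<forall>y\<in>F. (AE t in M. \<bar>x t\<bar> \<le> \<bar>y t\<bar>) \<longrightarrow> x \<in> F \<and> G x \<le> G y)"

definition order_bounded_disjoint ::
    "'a measure \<Rightarrow> (nat \<Rightarrow> 'a \<Rightarrow> real) \<Rightarrow> ('a \<Rightarrow> real) \<Rightarrow> bool" where
  "order_bounded_disjoint M X x \<longleftrightarrow>
     (AE t in M. (\<forall>n. 0 \<le> X n t \<and> X n t \<le> x t) \<and> (\<forall>m n. m \<noteq> n \<longrightarrow> X m t = 0 \<or> X n t = 0))"

lemma suminf_one_term: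
  fixes a z :: "nat \<Rightarrow> real"
  assumes "\<And>m n. m \<noteq> n \<Longrightarrow> a m = 0 \<or> a n = 0" and "a k \<noteq> 0"
  shows "(\<Sum>n. z n * a n) = z k * a k"
proof -
  have "(\<Sum>n. z n * a n) = (\<Sum>n\<in>{k}. z n * a n)"
    by (rule suminf_finite) (use assms in auto)
  then show ?thesis by simp
qed

lemma abs_le_l_infinity_norm:
  assumes "z \<in> l_infinity"
  shows "\<bar>z n\<bar> \<le> l_infinity_norm z"
proof -
  obtain B where "\<And>n. \<bar>z n\<bar> \<le> B"
    using assms unfolding l_infinity_def bounded_iff by auto
  then have "bdd_above (range (\<lambda>n. \<bar>z n\<bar>))"
    by (intro bdd_aboveI[of _ B]) auto
  then show ?thesis unfolding l_infinity_norm_def by (intro cSUP_upper) auto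
qed

text \<open>
  The copy consists of the sums \<open>\<Sum>n. z n * X n\<close>, which have at most one nonzero term at almost every
  point.
\<close>

lemma disjoint_sequence_imp_copy:
  assumes F: "ideal_functional M F G"
    and x: "x \<in> F" and X: "\<And>n. X n \<in> F" and ob: "order_bounded_disjoint M X x"
    and c: "0 < c" "\<And>n. c \<le> G (X n)"
  shows "contains_order_copy_l_infinity M F G"
proof -
  define P where "P z t = (\<Sum>n. z n * X n t)" for z t
  have meas: "y \<in> F \<Longrightarrow> y \<in> borel_measurable M" for y
    using F unfolding ideal_functional_def by blast
  have Pmeas: "P z \<in> borel_measurable M" for z
    unfolding P_def[abs_def] using meas[OF X] by measurable
  have scale: "y \<in> F \<Longrightarrow> (\<lambda>t. r * y t) \<in> F \<and> G (\<lambda>t. r * y t) = \<bar>r\<bar> * G y" for y r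
    using F unfolding ideal_functional_def by blast
  have ideal: "y \<in> F \<and> G y \<le> G y'"
    if "y \<in> borel_measurable M" "y' \<in> F" "AE t in M. \<bar>y t\<bar> \<le> \<bar>y' t\<bar>" for y y'
    using F that unfolding ideal_functional_def by blast
  have pointwise: "AE t in M. (\<forall>z. P z t = 0) \<and> (\<forall>n. X n t = 0) \<and> 0 \<le> x t \<or>
      (\<exists>k. 0 < X k t \<and> X k t \<le> x t \<and> (\<forall>n. n \<noteq> k \<longrightarrow> X n t = 0) \<and> (\<forall>z. P z t = z k * X k t))"
    using ob unfolding order_bounded_disjoint_def
  proof eventually_elim
    case (elim t)
    show ?case
    proof (cases "\<exists>k. X k t \<noteq> 0")
      case True
      then obtain k where k: "X k t \<noteq> 0" by blast
      have "\<forall>z. P z t = z k * X k t"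
        unfolding P_def using suminf_one_term[of "\<lambda>n. X n t" k] elim k by blast
      moreover have "0 < X k t" using elim k by (metis less_eq_real_def)
      ultimately show ?thesis using elim k by metis
    next
      case False
      then have "\<forall>z. P z t = 0" unfolding P_def by simp
      then show ?thesis using False elim by (metis order_trans)
    qed
  qed
  have bd: "P z \<in> F \<and> G (P z) \<le> l_infinity_norm z * G x" if z: "z \<in> l_infinity" for z
  proof -
    have nn: "0 \<le> l_infinity_norm z"
      using abs_le_l_infinity_norm[OF z, of 0] by linarith
    have "AE t in M. \<bar>P z t\<bar> \<le> \<bar>l_infinity_norm z * x t\<bar>"
      using pointwise
    proof eventually_elim
      case (elim t)
      then show ?case
      proof
        assume "\<exists>k. 0 < X k t \<and> X k t \<le> x t \<and> (\<forall>n. n \<noteq> k \<longrightarrow> X n t = 0) \<and> (\<forall>z. P z t = z k * X k t)"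
        then obtain k where k: "0 < X k t" "X k t \<le> x t" "P z t = z k * X k t" by blast
        show ?thesis unfolding k(3) abs_mult
          by (intro mult_mono) (use k abs_le_l_infinity_norm[OF z, of k] nn in auto)
      qed auto
    qed
    from ideal[OF Pmeas scale[OF x, THEN conjunct1] this]
    show ?thesis using scale[OF x, of "l_infinity_norm z"] nn by (metis abs_of_nonneg)
  qed
  have low: "c * l_infinity_norm z \<le> G (P z)" if z: "z \<in> l_infinity" for z
  proof -
    have "\<bar>z n\<bar> * G (X n) \<le> G (P z)" for n
    proof -
      have "AE t in M. \<bar>z n * X n t\<bar> \<le> \<bar>P z t\<bar>"
        using pointwise
      proof eventually_elim
        case (elim t)
        then show ?case
        proof (cases "X n t = 0")
          case False
          with elim have "P z t = z n * X n t" by metis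
          then show ?thesis by simp
        qed simp
      qed
      from ideal[OF _ bd[OF z, THEN conjunct1] this] show ?thesis
        using scale[OF X, of "z n" n] meas by metis
    qed
    moreover have "\<bar>z n\<bar> * c \<le> \<bar>z n\<bar> * G (X n)" for n using c by (intro mult_left_mono) auto
    ultimately have "\<bar>z n\<bar> * c \<le> G (P z)" for n by (meson order_trans)
    then have "l_infinity_norm z \<le> G (P z) / c"
      unfolding l_infinity_norm_def using c(1) by (intro cSUP_least) (auto simp: field_simps)
    then show ?thesis using c(1) by (simp add: field_simps)
  qed
  have Gx: "0 < G x"
  proof -
    have "AE t in M. \<bar>X 0 t\<bar> \<le> \<bar>x t\<bar>"
      using ob unfolding order_bounded_disjoint_def
    proof eventually_elim
      case (elim t)
      then have "0 \<le> X 0 t" "X 0 t \<le> x t" by blast+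
      then show ?case by simp
    qed
    from ideal[OF meas[OF X] x this] show ?thesis using c(1) c(2)[of 0] by linarith
  qed
  show ?thesis
    unfolding contains_order_copy_l_infinity_def
  proof (rule exI[of _ P], rule exI[of _ c], rule exI[of _ "G x"], intro conjI ballI allI)
    show "AE t in M. P (\<lambda>n. z n + w n) t = P z t + P w t" for z w
      using pointwise by eventually_elim (auto simp: algebra_simps)
    show "AE t in M. P (\<lambda>n. r * z n) t = r * P z t" for z r
      using pointwise by eventually_elim (auto simp: algebra_simps)
    show "AE t in M. \<bar>P z t\<bar> = P (\<lambda>n. \<bar>z n\<bar>) t" for z
      using pointwise by eventually_elim (auto simp: abs_mult)
  qed (use c Gx bd low in \<open>auto simp: mult.commute\<close>)
qed

text \<open>
  The images of the unit vectors are disjoint because \<open>P\<close> commutes with the modulus: the identity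
  \<open>\<bar>e m - e n\<bar> = e m + e n\<close> passes to the images, and \<open>\<bar>a - b\<bar> = a + b\<close> for nonnegative reals forces one
  of them to vanish.  The image of the constant sequence 1 is a common upper bound.
\<close>

lemma copy_imp_disjoint_sequence:
  assumes "contains_order_copy_l_infinity M F G"
  shows "\<exists>x X c. x \<in> F \<and> (\<forall>n. X n \<in> F) \<and> order_bounded_disjoint M X x \<and>
           (0::real) < c \<and> (\<forall>n. c \<le> G (X n))"
proof -
  from assms obtain P c where P:
      "0 < c" "\<forall>z\<in>l_infinity. P z \<in> F"
      "\<forall>z\<in>l_infinity. \<forall>w\<in>l_infinity. AE t in M. P (\<lambda>n. z n + w n) t = P z t + P w t"
      "\<forall>z\<in>l_infinity. \<forall>r. AE t in M. P (\<lambda>n. r * z n) t = r * P z t"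
      "\<forall>z\<in>l_infinity. AE t in M. \<bar>P z t\<bar> = P (\<lambda>n. \<bar>z n\<bar>) t"
      "\<forall>z\<in>l_infinity. c * l_infinity_norm z \<le> G (P z)"
    unfolding contains_order_copy_l_infinity_def by (elim exE conjE) (rule that, auto)
  note c = P(1) and PF = P(2)[rule_format] and add = P(3)[rule_format]
    and scale = P(4)[rule_format] and ab = P(5)[rule_format] and low = P(6)[rule_format]
  define e where "e k = (\<lambda>n. if n = k then 1 else 0 :: real)" for k :: nat
  have li: "z \<in> l_infinity" if "\<And>n. \<bar>z n\<bar> \<le> 2" for z
    unfolding l_infinity_def bounded_iff using that by auto
  have e: "e k \<in> l_infinity" for k by (rule li) (auto simp: e_def)
  have pos: "AE t in M. 0 \<le> P z t" if "\<And>n. 0 \<le> z n" "z \<in> l_infinity" for z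
  proof -
    have "(\<lambda>n. \<bar>z n\<bar>) = z" using that(1) by auto
    then show ?thesis using ab[OF that(2)] by (auto elim: eventually_mono)
  qed
  have epos: "AE t in M. 0 \<le> P (e n) t" for n by (rule pos[OF _ e]) (auto simp: e_def)
  have "AE t in M. 0 \<le> P (e n) t \<and> P (e n) t \<le> P (\<lambda>_. 1) t" for n
  proof -
    have co: "(\<lambda>k. 1 - e n k) \<in> l_infinity" by (rule li) (auto simp: e_def)
    have "AE t in M. 0 \<le> P (\<lambda>k. 1 - e n k) t" by (rule pos[OF _ co]) (auto simp: e_def)
    then show ?thesis using epos[of n] add[OF e[of n] co] by eventually_elim simp
  qed
  moreover have "AE t in M. m \<noteq> n \<longrightarrow> P (e m) t = 0 \<or> P (e n) t = 0" for m n
  proof (cases "m = n")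
    case False
    have ne: "(\<lambda>k. (-1) * e n k) \<in> l_infinity" by (rule li) (auto simp: e_def)
    have d: "(\<lambda>k. e m k + (-1) * e n k) \<in> l_infinity" by (rule li) (auto simp: e_def)
    have eq: "(\<lambda>k. \<bar>e m k + (-1) * e n k\<bar>) = (\<lambda>k. e m k + e n k)"
      using False by (auto simp: e_def)
    show ?thesis
      using add[OF e[of m] ne] scale[OF e[of n], of "-1"] ab[OF d] add[OF e[of m] e[of n]]
        epos[of m] epos[of n] unfolding eq
      by eventually_elim auto
  qed simp
  ultimately have "order_bounded_disjoint M (\<lambda>n. P (e n)) (P (\<lambda>_. 1))"
    unfolding order_bounded_disjoint_def by (simp add: AE_all_countable AE_conj_iff)
  moreover have "c \<le> G (P (e n))" for n
  proof -
    have "1 \<le> l_infinity_norm (e n)"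
      using abs_le_l_infinity_norm[OF e, of n n] by (simp add: e_def)
    then have "c * 1 \<le> c * l_infinity_norm (e n)" using c by (intro mult_left_mono) auto
    then show ?thesis using low[OF e, of n] by simp
  qed
  ultimately show ?thesis
    using PF[OF e] PF[OF li, of "\<lambda>_. 1"] c
    by (intro exI[of _ "P (\<lambda>_. 1)"] exI[of _ "\<lambda>n. P (e n)"] exI[of _ c]) simp
qed

section \<open>Quasi-Banach ideal spaces\<close>

locale quasi_banach_ideal =
  fixes M :: "'a measure" and E :: "('a \<Rightarrow> real) set" and N :: "('a \<Rightarrow> real) \<Rightarrow> real"
  assumes space: "quasi_banach_ideal_space M E N"
begin

lemma measurable_of_mem: "x \<in> E \<Longrightarrow> x \<in> borel_measurable M"
  using space unfolding quasi_banach_ideal_space_def by blast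

lemma zero_mem: "(\<lambda>t. 0) \<in> E"
  using space unfolding quasi_banach_ideal_space_def by blast

lemma add_mem: "x \<in> E \<Longrightarrow> y \<in> E \<Longrightarrow> (\<lambda>t. x t + y t) \<in> E"
  using space unfolding quasi_banach_ideal_space_def by blast

lemma scale_mem: "x \<in> E \<Longrightarrow> (\<lambda>t. c * x t) \<in> E"
  using space unfolding quasi_banach_ideal_space_def by blast

lemma quasi_norm: "quasi_norm_on M E N"
  using space unfolding quasi_banach_ideal_space_def by blast

lemma N_nonneg: "x \<in> E \<Longrightarrow> 0 \<le> N x"
  using quasi_norm unfolding quasi_norm_on_def by blast

lemma N_eq_0_iff: "x \<in> E \<Longrightarrow> N x = 0 \<longleftrightarrow> (AE t in M. x t = 0)"
  using quasi_norm unfolding quasi_norm_on_def by blast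

lemma N_scale: "x \<in> E \<Longrightarrow> N (\<lambda>t. c * x t) = \<bar>c\<bar> * N x"
  using quasi_norm unfolding quasi_norm_on_def by blast

lemma ideal:
  assumes "x \<in> borel_measurable M" "y \<in> E" "AE t in M. \<bar>x t\<bar> \<le> \<bar>y t\<bar>"
  shows ideal_mem: "x \<in> E" and N_mono: "N x \<le> N y"
  using space assms unfolding quasi_banach_ideal_space_def by blast+

lemma ideal_functional: "ideal_functional M E N"
  unfolding ideal_functional_def
  using measurable_of_mem scale_mem N_scale ideal_mem N_mono by (intro conjI) blast+

definition modulus :: real where
  "modulus = (SOME C. 1 \<le> C \<and> (\<forall>x\<in>E. \<forall>y\<in>E. N (\<lambda>t. x t + y t) \<le> C * (N x + N y)))"

lemma modulus_ge_1: "1 \<le> modulus"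
  and quasi_triangle: "x \<in> E \<Longrightarrow> y \<in> E \<Longrightarrow> N (\<lambda>t. x t + y t) \<le> modulus * (N x + N y)"
proof -
  have "\<exists>C. 1 \<le> C \<and> (\<forall>x\<in>E. \<forall>y\<in>E. N (\<lambda>t. x t + y t) \<le> C * (N x + N y))"
    using quasi_norm unfolding quasi_norm_on_def by blast
  from someI_ex[OF this]
  show "1 \<le> modulus" "x \<in> E \<Longrightarrow> y \<in> E \<Longrightarrow> N (\<lambda>t. x t + y t) \<le> modulus * (N x + N y)"
    unfolding modulus_def by blast+
qed

lemma complete: "complete_quasi_norm_on E N"
  using space unfolding quasi_banach_ideal_space_def by blast

lemma abs_mem: "x \<in> E \<Longrightarrow> (\<lambda>t. \<bar>x t\<bar>) \<in> E"
  and N_abs: "x \<in> E \<Longrightarrow> N (\<lambda>t. \<bar>x t\<bar>) = N x"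
proof -
  assume x: "x \<in> E"
  have m: "(\<lambda>t. \<bar>x t\<bar>) \<in> borel_measurable M" using measurable_of_mem[OF x] by measurable
  show mem: "(\<lambda>t. \<bar>x t\<bar>) \<in> E" by (rule ideal_mem[OF m x]) simp
  show "N (\<lambda>t. \<bar>x t\<bar>) = N x"
    using N_mono[OF m x] N_mono[OF measurable_of_mem[OF x] mem] by simp
qed

text \<open>
  The Riesz-Fischer principle for a quasi-norm.  Each application of the quasi-triangle inequality
  costs a factor \<open>modulus\<close>, and the geometric rate is chosen to absorb it, so the partial sums of
  the moduli are Cauchy.  Their limit dominates every partial sum, since the positive part of
  \<open>S m - y\<close> is below \<open>\<bar>S n - y\<bar>\<close> for all \<open>n \<ge> m\<close>.
\<close>

lemma summable_norms_dominated:
  assumes x: "\<And>n. x n \<in> E" and small: "\<And>n. N (x n) \<le> (1 / (2 * modulus)) ^ Suc n"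
  obtains y where "y \<in> E" and "AE t in M. \<forall>n. \<bar>x n t\<bar> \<le> y t"
proof -
  define q where "q = 1 / (2 * modulus)"
  have q: "0 < q" "modulus * (2 * q) = 1" "q < 1"
    using modulus_ge_1 unfolding q_def by (auto simp: field_simps)
  define T where "T m j = (\<lambda>t. \<Sum>i<j. \<bar>x (m + i) t\<bar>)" for m j
  have T: "T m j \<in> E \<and> N (T m j) \<le> q ^ m" for m j
  proof (induction j arbitrary: m)
    case 0
    have "N (\<lambda>t. 0) = 0" using N_eq_0_iff[OF zero_mem] by simp
    then show ?case using q zero_mem by (simp add: T_def)
  next
    case (Suc j)
    have eq: "T m (Suc j) = (\<lambda>t. \<bar>x m t\<bar> + T (Suc m) j t)"
      unfolding T_def by (simp only: sum.lessThan_Suc_shift) simp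
    have "N (T m (Suc j)) \<le> modulus * (N (\<lambda>t. \<bar>x m t\<bar>) + N (T (Suc m) j))"
      unfolding eq using quasi_triangle[OF abs_mem[OF x]] Suc.IH by blast
    also have "\<dots> \<le> modulus * (q ^ Suc m + q ^ Suc m)"
      using modulus_ge_1 small[of m] Suc.IH[of "Suc m"] N_abs[OF x, of m]
      unfolding q_def by (intro mult_left_mono add_mono) auto
    also have "\<dots> = (modulus * (2 * q)) * q ^ m" by (simp add: algebra_simps)
    finally show ?case using q add_mem[OF abs_mem[OF x]] Suc.IH unfolding eq by simp
  qed
  define S where "S n = T 0 n" for n
  have diff: "(\<lambda>t. S n t - S m t) = T m (n - m)" if "m \<le> n" for m n
  proof
    fix t
    have "(\<Sum>i<m + k. \<bar>x i t\<bar>) = (\<Sum>i<m. \<bar>x i t\<bar>) + (\<Sum>i<k. \<bar>x (m + i) t\<bar>)"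
      for k by (induction k) auto
    from this[of "n - m"] show "S n t - S m t = T m (n - m) t" using that unfolding S_def T_def by simp
  qed
  have cauchy: "\<forall>e>0. \<exists>k. \<forall>m\<ge>k. \<forall>n\<ge>k. N (\<lambda>t. S m t - S n t) < e"
  proof (intro allI impI)
    fix e :: real assume "0 < e"
    then obtain k where k: "q ^ k < e" using q real_arch_pow_inv by blast
    have less: "N (\<lambda>t. S n t - S m t) < e" if "k \<le> m" "m \<le> n" for m n
    proof -
      have "q ^ m \<le> q ^ k" using q that by (intro power_decreasing) auto
      then show ?thesis using T[of m "n - m"] k that by (simp add: diff)
    qed
    have "N (\<lambda>t. S m t - S n t) < e" if "k \<le> m" "k \<le> n" for m n
    proof (cases "m \<le> n")
      case True
      have "(\<lambda>t. S m t - S n t) = (\<lambda>t. (-1) * (S n t - S m t))" by auto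
      then show ?thesis using less[OF that(1) True] N_scale[of "\<lambda>t. S n t - S m t" "-1"] T True
        by (simp add: diff)
    qed (use less that in auto)
    then show "\<exists>k. \<forall>m\<ge>k. \<forall>n\<ge>k. N (\<lambda>t. S m t - S n t) < e" by blast
  qed
  have "\<forall>n. S n \<in> E" using T unfolding S_def by blast
  then obtain y where y: "y \<in> E" and lim: "(\<lambda>n. N (\<lambda>t. S n t - y t)) \<longlonglongrightarrow> 0"
    using complete cauchy unfolding complete_quasi_norm_on_def by blast
  have [measurable]: "S n \<in> borel_measurable M" "y \<in> borel_measurable M" for n
    using T measurable_of_mem y unfolding S_def by blast+
  have S_le: "S m t \<le> S n t" if "m \<le> n" for m n t
  proof -
    have "0 \<le> T m (n - m) t" unfolding T_def by (simp add: sum_nonneg)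
    then show ?thesis using diff[OF that] by (metis diff_ge_0_iff_ge)
  qed
  have "AE t in M. S m t \<le> y t" for m
  proof -
    \<comment> \<open>The positive part of \<open>S m - y\<close> has norm zero.\<close>
    let ?p = "\<lambda>t. max 0 (S m t - y t)"
    have d: "(\<lambda>t. S n t - y t) \<in> E" for n
      using add_mem[of "S n" "\<lambda>t. (-1) * y t"] T scale_mem[OF y, of "-1"] unfolding S_def by simp
    have m: "?p \<in> borel_measurable M" by measurable
    have pE: "?p \<in> E" by (rule ideal_mem[OF m d[of m]]) auto
    have "N ?p \<le> N (\<lambda>t. S n t - y t)" if "m \<le> n" for n
      by (rule N_mono[OF m d]) (use S_le[OF that] in \<open>auto intro!: AE_I2 simp: max_def, smt (verit)\<close>)
    then have "N ?p \<le> 0" using lim by (intro LIMSEQ_le_const[OF lim]) auto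
    then have "AE t in M. ?p t = 0" using N_nonneg[OF pE] N_eq_0_iff[OF pE] by simp
    then show ?thesis by eventually_elim (auto simp: max_def split: if_splits)
  qed
  then have all: "AE t in M. \<forall>m. S m t \<le> y t" by (simp add: AE_all_countable)
  have le: "\<bar>x n t\<bar> \<le> S (Suc n) t" for n t
    unfolding S_def T_def by (simp add: sum_nonneg)
  show ?thesis
  proof (rule that[OF y])
    show "AE t in M. \<forall>n. \<bar>x n t\<bar> \<le> y t" using all by eventually_elim (meson le order_trans)
  qed
qed

text \<open>
  A closed-graph argument.  If no constant works, there are functions of norm \<open>q n\<close>, with \<open>q\<close>
  geometrically small, whose modulus exceeds \<open>n + 1\<close> on a set of positive measure.  A single element
  of \<open>E\<close> dominates them all, and it would be unbounded.
\<close>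

lemma sup_norm_bound:
  assumes "E \<subseteq> L_infinity M"
  obtains B where "0 < B" and "\<And>x. x \<in> E \<Longrightarrow> AE t in M. \<bar>x t\<bar> \<le> B * N x"
proof -
  define q where "q n = (1 / (2 * modulus)) ^ Suc n" for n
  have q: "0 < q n" for n using modulus_ge_1 unfolding q_def by simp
  have "\<exists>B>0. \<forall>x\<in>E. AE t in M. \<bar>x t\<bar> \<le> B * N x"
  proof (rule ccontr)
    assume not: "\<not> ?thesis"
    have "\<exists>x\<in>E. \<not> (AE t in M. \<bar>x t\<bar> \<le> real (Suc n) / q n * N x)" for n
      using not q[of n] by (metis divide_pos_pos of_nat_0_less_iff zero_less_Suc)
    then obtain x where x: "\<And>n. x n \<in> E"
      and big: "\<And>n. \<not> (AE t in M. \<bar>x n t\<bar> \<le> real (Suc n) / q n * N (x n))" by metis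
    have Nx: "0 < N (x n)" for n
    proof (rule ccontr)
      assume "\<not> 0 < N (x n)"
      then have z: "N (x n) = 0" using N_nonneg[OF x] by (metis less_eq_real_def)
      then have "AE t in M. x n t = 0" using N_eq_0_iff[OF x] by simp
      then show False using big[of n] z by (auto elim: eventually_mono)
    qed
    define w where "w n = (\<lambda>t. q n / N (x n) * x n t)" for n
    have w: "w n \<in> E" "N (w n) \<le> q n" for n
      using scale_mem[OF x, of "q n / N (x n)" n] N_scale[OF x, of "q n / N (x n)" n] Nx[of n] q[of n]
      unfolding w_def by auto
    obtain y where y: "y \<in> E" "AE t in M. \<forall>n. \<bar>w n t\<bar> \<le> y t"
      using summable_norms_dominated[of w] w unfolding q_def by blast
    obtain B where B: "AE t in M. \<bar>y t\<bar> \<le> B" using assms y unfolding L_infinity_def by blast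
    obtain n where n: "B < real (Suc n)" using reals_Archimedean2 by (metis less_SucI of_nat_less_iff less_trans lessI)
    have "AE t in M. \<bar>x n t\<bar> \<le> real (Suc n) / q n * N (x n)"
      using y(2) B
    proof eventually_elim
      case (elim t)
      then have "\<bar>w n t\<bar> \<le> real (Suc n)" using n by (smt (verit))
      then show ?case using Nx[of n] q[of n] unfolding w_def by (simp add: abs_mult field_simps)
    qed
    then show False using big by blast
  qed
  then show ?thesis using that by blast
qed

lemma indicator_measurable: "A \<in> sets M \<Longrightarrow> (indicator A :: 'a \<Rightarrow> real) \<in> borel_measurable M"
  by simp

lemma indicator_subset:
  assumes "(indicator B :: 'a \<Rightarrow> real) \<in> E" "A \<in> sets M" "A \<subseteq> B"
  shows indicator_subset_mem: "(indicator A :: 'a \<Rightarrow> real) \<in> E"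
    and N_indicator_mono: "N (indicator A) \<le> N (indicator B)"
proof -
  have "AE t in M. \<bar>indicator A t :: real\<bar> \<le> \<bar>indicator B t\<bar>"
    using assms(3) by (auto simp: indicator_def)
  then show "(indicator A :: 'a \<Rightarrow> real) \<in> E" "N (indicator A) \<le> N (indicator B)"
    using ideal[OF indicator_measurable[OF assms(2)] assms(1)] by auto
qed

lemma indicator_Un:
  assumes "(indicator A :: 'a \<Rightarrow> real) \<in> E" "(indicator B :: 'a \<Rightarrow> real) \<in> E" "A \<in> sets M" "B \<in> sets M"
  shows indicator_Un_mem: "(indicator (A \<union> B) :: 'a \<Rightarrow> real) \<in> E"
    and N_indicator_Un: "N (indicator (A \<union> B)) \<le> modulus * (N (indicator A) + N (indicator B))"
proof -
  have m: "(indicator (A \<union> B) :: 'a \<Rightarrow> real) \<in> borel_measurable M" using assms by simp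
  have "AE t in M. \<bar>indicator (A \<union> B) t :: real\<bar> \<le> \<bar>indicator A t + indicator B t\<bar>"
    by (auto simp: indicator_def)
  note * = ideal[OF m add_mem[OF assms(1,2)] this]
  show "(indicator (A \<union> B) :: 'a \<Rightarrow> real) \<in> E" by (rule *)
  show "N (indicator (A \<union> B)) \<le> modulus * (N (indicator A) + N (indicator B))"
    using *(2) quasi_triangle[OF assms(1,2)] by linarith
qed

lemma N_indicator_eq_0_iff:
  assumes "(indicator A :: 'a \<Rightarrow> real) \<in> E" "A \<in> sets M"
  shows "N (indicator A) = 0 \<longleftrightarrow> emeasure M A = 0"
proof -
  have "{t \<in> space M. \<not> (indicator A t :: real) = 0} = A"
    using sets.sets_into_space[OF assms(2)] by (auto simp: indicator_def)
  then show ?thesis using N_eq_0_iff[OF assms(1)] AE_iff_measurable[OF assms(2)] by metis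
qed

text \<open>
  The sets where a strictly positive element of \<open>E\<close> exceeds \<open>1 / (k + 1)\<close>.
\<close>

lemma exhaustion:
  obtains S :: "nat \<Rightarrow> 'a set" where "incseq S" and "\<And>k. S k \<in> sets M"
    and "\<And>k. (indicator (S k) :: 'a \<Rightarrow> real) \<in> E" and "AE t in M. \<exists>k. t \<in> S k"
proof -
  obtain x where x: "x \<in> E" "AE t in M. 0 < x t"
    using space unfolding quasi_banach_ideal_space_def by blast
  have [measurable]: "x \<in> borel_measurable M" using x measurable_of_mem by blast
  define S where "S k = {t \<in> space M. 1 / real (Suc k) < x t}" for k
  have S: "S k \<in> sets M" for k unfolding S_def by measurable
  show ?thesis
  proof (rule that[OF _ S])
    have "1 / real (Suc n) \<le> 1 / real (Suc m)" if "m \<le> n" for m n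
      using that by (intro divide_left_mono) auto
    then show "incseq S" unfolding incseq_def S_def by (auto intro: order_le_less_trans)
    show "(indicator (S k) :: 'a \<Rightarrow> real) \<in> E" for k
    proof (rule ideal_mem[OF indicator_measurable[OF S] scale_mem[OF x(1), of "real (Suc k)"]])
      have "\<bar>indicator (S k) t\<bar> \<le> \<bar>real (Suc k) * x t\<bar>" for t
        by (auto simp: S_def indicator_def field_simps)
      then show "AE t in M. \<bar>indicator (S k) t\<bar> \<le> \<bar>real (Suc k) * x t\<bar>" by simp
    qed
    have arch: "\<exists>k. 1 / real (Suc k) < x t" if "0 < x t" for t
      using reals_Archimedean[OF that] by (simp add: inverse_eq_divide)
    show "AE t in M. \<exists>k. t \<in> S k"
      using x(2) AE_space[of M]
    proof eventually_elim
      case (elim t)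
      then show ?case using arch unfolding S_def by blast
    qed
  qed
qed

end

text \<open>
  Splitting repeatedly one of the two parts gives a decreasing sequence \<open>R\<close>; the sets are its
  successive differences.
\<close>

lemma nonatomic_disjoint_sequence:
  assumes na: "nonatomic M" and A: "A \<in> sets M" "emeasure M A \<noteq> 0"
  obtains D :: "nat \<Rightarrow> 'a set" where "disjoint_family D"
    and "\<And>n. D n \<in> sets M" and "\<And>n. D n \<subseteq> A" and "\<And>n. emeasure M (D n) \<noteq> 0"
proof -
  let ?P = "\<lambda>R. R \<in> sets M \<and> emeasure M R \<noteq> 0 \<and> R \<subseteq> A"
  have step: "\<exists>R'. ?P R' \<and> R' \<subseteq> R \<and> emeasure M (R - R') \<noteq> 0" if "?P R" for R
  proof -
    have R: "R \<in> sets M" "emeasure M R > 0" "R \<subseteq> A" using that by (auto simp: zero_less_iff_neq_zero)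
    have "\<not> (\<forall>B\<in>sets M. B \<subseteq> R \<longrightarrow> emeasure M B = 0 \<or> emeasure M (R - B) = 0)"
      using na R(1,2) unfolding nonatomic_def by blast
    then obtain B where B: "B \<in> sets M" "B \<subseteq> R" "emeasure M B \<noteq> 0" "emeasure M (R - B) \<noteq> 0"
      by blast
    show ?thesis by (rule exI[of _ B]) (use B R in auto)
  qed
  have "\<exists>R. \<forall>n::nat. ?P (R n) \<and> (R (Suc n) \<subseteq> R n \<and> emeasure M (R n - R (Suc n)) \<noteq> 0)"
    by (rule dependent_nat_choice) (use A step in blast)+
  then obtain R where R: "\<And>n::nat. ?P (R n)"
    and dec: "\<And>n. R (Suc n) \<subseteq> R n \<and> emeasure M (R n - R (Suc n)) \<noteq> 0" by blast
  have anti: "R n \<subseteq> R m" if "m \<le> n" for m n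
    using that by (induction rule: dec_induct) (use dec in auto)
  show ?thesis
  proof (rule that[of "\<lambda>n. R n - R (Suc n)"])
    have "(R m - R (Suc m)) \<inter> (R n - R (Suc n)) = {}" if "m < n" for m n
      using anti[of "Suc m" n] that by auto
    then show "disjoint_family (\<lambda>n. R n - R (Suc n))"
      unfolding disjoint_family_on_def by (metis Int_commute linorder_neqE_nat)
  qed (use R dec in auto)
qed

section \<open>Order continuity in spaces without a copy\<close>

context quasi_banach_ideal
begin

lemma positive_indicator_mem:
  assumes "emeasure M (space M) > 0"
  obtains A where "A \<in> sets M" "(indicator A :: 'a \<Rightarrow> real) \<in> E" "emeasure M A \<noteq> 0"
proof -
  obtain S :: "nat \<Rightarrow> 'a set" where S: "\<And>k. S k \<in> sets M"
    "\<And>k. (indicator (S k) :: 'a \<Rightarrow> real) \<in> E" "AE t in M. \<exists>k. t \<in> S k"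
    by (rule exhaustion) blast
  have "\<exists>k. emeasure M (S k) \<noteq> 0"
  proof (rule ccontr)
    assume "\<not> ?thesis"
    then have "S k \<in> null_sets M" for k using S(1) by auto
    then have "AE t in M. \<forall>k. t \<notin> S k" by (simp add: AE_all_countable AE_not_in)
    then have "AE t in M. False" using S(3) by eventually_elim blast
    then show False using assms by (simp add: eventually_False ae_filter_eq_bot_iff)
  qed
  then show ?thesis using that S by blast
qed

lemma disjoint_indicators_copy:
  fixes D :: "nat \<Rightarrow> 'a set"
  assumes D: "disjoint_family D" "\<And>n. D n \<in> sets M" "\<And>n. D n \<subseteq> B"
    and B: "(indicator B :: 'a \<Rightarrow> real) \<in> E" and c: "0 < c" "\<And>n. c \<le> N (indicator (D n))"
  shows "contains_order_copy_l_infinity M E N"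
proof (rule disjoint_sequence_imp_copy[where X = "\<lambda>n. indicator (D n)", OF ideal_functional B _ _ c])
  show "(indicator (D n) :: 'a \<Rightarrow> real) \<in> E" for n by (rule indicator_subset_mem[OF B D(2,3)])
  have "indicator (D n) t \<le> (indicator B t :: real)" for n t
    using D(3)[of n] by (auto simp: indicator_def)
  moreover have "indicator (D m) t = (0::real) \<or> indicator (D n) t = (0::real)" if "m \<noteq> n" for m n t
    using disjoint_family_onD[OF D(1) _ _ that] by (auto simp: indicator_def)
  ultimately show "order_bounded_disjoint M (\<lambda>n. indicator (D n)) (indicator B)"
    unfolding order_bounded_disjoint_def by (intro AE_I2) simp
qed

text \<open>
  Since the norm of \<open>E\<close> dominates a multiple of the supremum norm, all indicators of sets of positive
  measure have norm bounded below.
\<close>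

lemma subspace_of_L_infinity_copy:
  assumes "nonatomic M" "emeasure M (space M) > 0" "E \<subseteq> L_infinity M"
  shows "contains_order_copy_l_infinity M E N"
proof -
  obtain B where B: "0 < B" "\<And>x. x \<in> E \<Longrightarrow> AE t in M. \<bar>x t\<bar> \<le> B * N x"
    using sup_norm_bound[OF assms(3)] by blast
  obtain A where A: "A \<in> sets M" "(indicator A :: 'a \<Rightarrow> real) \<in> E" "emeasure M A \<noteq> 0"
    using positive_indicator_mem[OF assms(2)] by blast
  obtain D :: "nat \<Rightarrow> 'a set" where D: "disjoint_family D"
    "\<And>n. D n \<in> sets M" "\<And>n. D n \<subseteq> A" "\<And>n. emeasure M (D n) \<noteq> 0"
    using nonatomic_disjoint_sequence[OF assms(1) A(1,3)] by blast
  have "1 / B \<le> N (indicator (D n))" for n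
  proof (rule ccontr)
    assume "\<not> ?thesis"
    then have less: "B * N (indicator (D n)) < 1" using B(1) by (simp add: field_simps)
    have mem: "(indicator (D n) :: 'a \<Rightarrow> real) \<in> E" by (rule indicator_subset_mem[OF A(2) D(2,3)])
    from B(2)[OF mem] have "AE t in M. indicator (D n) t = (0::real)"
      by eventually_elim (use less in \<open>auto simp: indicator_def split: if_splits\<close>)
    then have "N (indicator (D n)) = 0" using N_eq_0_iff[OF mem] by simp
    then show False using N_indicator_eq_0_iff[OF mem D(2)] D(4) by simp
  qed
  then show ?thesis
    using disjoint_indicators_copy[OF D(1-3) A(2), of "1 / B"] B(1) by simp
qed

lemma disjoint_indicators_tendsto_zero:
  assumes no_copy: "\<not> contains_order_copy_l_infinity M E N"
    and D: "disjoint_family D" "\<And>n::nat. D n \<in> sets M" "\<And>n. D n \<subseteq> B"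
    and B: "(indicator B :: 'a \<Rightarrow> real) \<in> E"
  shows "(\<lambda>n. N (indicator (D n))) \<longlonglongrightarrow> 0"
proof (rule ccontr)
  assume "\<not> ?thesis"
  then obtain e where e: "0 < e" "\<And>k. \<exists>n\<ge>k. e \<le> \<bar>N (indicator (D n))\<bar>"
    unfolding LIMSEQ_iff by (auto simp: not_less)
  have nn: "0 \<le> N (indicator (D n))" for n
    by (rule N_nonneg[OF indicator_subset_mem[OF B D(2,3)]])
  have "infinite {n. e \<le> N (indicator (D n))}"
    unfolding infinite_nat_iff_unbounded_le using e(2) nn by (metis abs_of_nonneg mem_Collect_eq)
  then obtain r :: "nat \<Rightarrow> nat" where r: "strict_mono r" "\<And>n. r n \<in> {n. e \<le> N (indicator (D n))}"
    using infinite_enumerate by blast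
  have "disjoint_family (\<lambda>n. D (r n))"
    using D(1) strict_mono_eq[OF r(1)] unfolding disjoint_family_on_def by simp
  then have "contains_order_copy_l_infinity M E N"
    by (rule disjoint_indicators_copy[OF _ _ _ B e(1)]) (use D r in auto)
  then show False using no_copy by blast
qed

end

locale fatou_ideal = quasi_banach_ideal +
  assumes fatou: "fatou_property M E N"
begin

lemma fatou_sets:
  assumes S: "incseq S" "\<And>k::nat. S k \<in> sets M" "\<And>k. (indicator (S k) :: 'a \<Rightarrow> real) \<in> E"
    and bd: "\<And>k. N (indicator (S k)) \<le> c"
    and T: "T \<in> sets M" "AE t in M. t \<in> T \<longleftrightarrow> (\<exists>k. t \<in> S k)"
  shows fatou_sets_mem: "(indicator T :: 'a \<Rightarrow> real) \<in> E"
    and fatou_sets_tendsto: "(\<lambda>k. N (indicator (S k))) \<longlonglongrightarrow> N (indicator T)"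
proof -
  have inc: "incseq (\<lambda>n. indicator (S n) t :: real)" for t
    using S(1) unfolding incseq_def by (auto simp: indicator_def)
  have "AE t in M. (\<forall>n. 0 \<le> (indicator (S n) t :: real)) \<and> incseq (\<lambda>n. indicator (S n) t :: real) \<and>
      (\<lambda>n. indicator (S n) t) \<longlonglongrightarrow> \<bar>indicator T t :: real\<bar>"
    using T(2)
  proof eventually_elim
    case (elim t)
    have "(\<lambda>n. indicator (S n) t :: real) \<longlonglongrightarrow> indicator (\<Union>n. S n) t"
      by (rule LIMSEQ_indicator_incseq[OF S(1)])
    moreover have "indicator (\<Union>n. S n) t = (indicator T t :: real)"
      using elim by (auto simp: indicator_def)
    ultimately show ?case using inc by simp
  qed
  moreover have "bdd_above (range (\<lambda>n. N (indicator (S n))))"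
    by (rule bdd_aboveI[of _ c]) (use bd in auto)
  ultimately have "(indicator T :: 'a \<Rightarrow> real) \<in> E \<and> (\<lambda>n. N (indicator (S n))) \<longlonglongrightarrow> N (indicator T)"
    using fatou[unfolded fatou_property_def, rule_format, of "\<lambda>n. indicator (S n)" "indicator T"]
      S(3) indicator_measurable[OF T(1)] by blast
  then show "(indicator T :: 'a \<Rightarrow> real) \<in> E" "(\<lambda>k. N (indicator (S k))) \<longlonglongrightarrow> N (indicator T)"
    by blast+
qed

text \<open>
  If the norms stay above \<open>e\<close>, the Fatou property shows that \<open>A n - A m\<close> has norm above \<open>e / 2\<close> for
  large \<open>m\<close>, because these sets increase to \<open>A n\<close>.  Iterating gives disjoint subsets of \<open>B\<close> with
  norms above \<open>e / 2\<close>, which span a copy.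
\<close>

lemma order_continuous_at_empty:
  assumes no_copy: "\<not> contains_order_copy_l_infinity M E N"
    and A: "decseq A" "\<And>n::nat. A n \<in> sets M" "\<And>n. A n \<subseteq> B" "(\<Inter>n. A n) = {}"
    and B: "(indicator B :: 'a \<Rightarrow> real) \<in> E"
  shows "(\<lambda>n. N (indicator (A n))) \<longlonglongrightarrow> 0"
proof (rule ccontr)
  assume "\<not> ?thesis"
  then obtain e where e: "0 < e" "\<And>k. \<exists>n\<ge>k. e \<le> \<bar>N (indicator (A n))\<bar>"
    unfolding LIMSEQ_iff by (auto simp: not_less)
  have mem: "(indicator (A n) :: 'a \<Rightarrow> real) \<in> E" for n by (rule indicator_subset_mem[OF B A(2,3)])
  have ge: "e \<le> N (indicator (A n))" for n
  proof -
    obtain m where m: "n \<le> m" "e \<le> \<bar>N (indicator (A m))\<bar>" using e(2) by blast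
    have "A m \<subseteq> A n" using A(1) m(1) by (rule decseqD)
    then show ?thesis using N_indicator_mono[OF mem A(2), of m n] m(2) N_nonneg[OF mem, of m] by linarith
  qed
  have step: "\<exists>m>n. e / 2 < N (indicator (A n - A m))" for n
  proof -
    have dm: "(indicator (A n - A m) :: 'a \<Rightarrow> real) \<in> E" for m
      by (rule indicator_subset_mem[OF mem[of n]]) (use A(2) in auto)
    have "(\<lambda>m. N (indicator (A n - A m))) \<longlonglongrightarrow> N (indicator (A n))"
    proof (rule fatou_sets_tendsto[OF _ _ dm _ A(2)])
      show "incseq (\<lambda>m. A n - A m)" using A(1) unfolding incseq_def decseq_def by blast
      show "N (indicator (A n - A m)) \<le> N (indicator (A n))" for m
        by (rule N_indicator_mono[OF mem]) (use A(2) in auto)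
      show "AE t in M. (t \<in> A n) = (\<exists>m. t \<in> A n - A m)" using A(4) by (intro AE_I2) blast
    qed (use A(2) in auto)
    moreover have "e / 2 < N (indicator (A n))" using ge[of n] e(1) by simp
    ultimately have "\<forall>\<^sub>F m in sequentially. e / 2 < N (indicator (A n - A m))"
      by (rule order_tendstoD)
    then have "\<forall>\<^sub>F m in sequentially. n < m \<and> e / 2 < N (indicator (A n - A m))"
      using eventually_gt_at_top[of n] by eventually_elim simp
    then show ?thesis using eventually_happens sequentially_bot by blast
  qed
  have "\<exists>r. \<forall>k::nat. True \<and> (r k < r (Suc k) \<and> e / 2 < N (indicator (A (r k) - A (r (Suc k)))))"
    by (rule dependent_nat_choice) (use step in auto)
  then obtain r :: "nat \<Rightarrow> nat" where r: "\<And>k. r k < r (Suc k)"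
    "\<And>k. e / 2 < N (indicator (A (r k) - A (r (Suc k))))" by blast
  define D where "D k = A (r k) - A (r (Suc k))" for k
  have sm: "strict_mono r" using r(1) by (simp add: strict_mono_Suc_iff)
  have "D m \<inter> D n = {}" if "m < n" for m n
  proof -
    have "r (Suc m) \<le> r n" using that strict_mono_less_eq[OF sm] by simp
    then show ?thesis unfolding D_def using decseqD[OF A(1)] by blast
  qed
  then have disj: "disjoint_family D"
    unfolding disjoint_family_on_def by (metis Int_commute linorder_neqE_nat)
  have "(\<lambda>k. N (indicator (D k))) \<longlonglongrightarrow> 0"
    by (rule disjoint_indicators_tendsto_zero[OF no_copy disj _ _ B]) (use A(2,3) D_def in auto)
  then have "\<forall>\<^sub>F k in sequentially. N (indicator (D k)) < e / 2"
    by (rule order_tendstoD) (use e in simp)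
  then show False using r(2) unfolding D_def eventually_sequentially by (meson less_asym order_refl)
qed

text \<open>
  A substitute for the intermediate value theorem, which is not directly available since a quasi-norm
  need not be continuous.  A greedy exhaustion by sets of almost maximal norm produces a set \<open>U\<close> with
  norm at most \<open>\<theta>\<close> that cannot be enlarged by a set of positive measure.  The rest \<open>B - U\<close> is not null
  and contains sets \<open>T j\<close> of positive measure decreasing to the empty set.  By maximality the norm of
  \<open>U \<union> T j\<close> exceeds \<open>\<theta>\<close>, while the norm of \<open>T j\<close> tends to zero, so the norm of \<open>U\<close> is at least
  \<open>\<theta> / modulus\<close>.
\<close>

lemma indicator_with_prescribed_norm:
  assumes no_copy: "\<not> contains_order_copy_l_infinity M E N" and na: "nonatomic M"
    and B: "B \<in> sets M" "(indicator B :: 'a \<Rightarrow> real) \<in> E"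
    and \<theta>: "0 \<le> \<theta>" "\<theta> < N (indicator B)"
  obtains A where "A \<in> sets M" "A \<subseteq> B" "N (indicator A) \<le> \<theta>" "\<theta> \<le> modulus * N (indicator A)"
proof -
  let ?n = "\<lambda>A. N (indicator A)"
  have mem: "(indicator A :: 'a \<Rightarrow> real) \<in> E" if "A \<in> sets M" "A \<subseteq> B" for A
    by (rule indicator_subset_mem[OF B(2) that])
  have mono: "?n A \<le> ?n A'" if "A \<in> sets M" "A' \<in> sets M" "A \<subseteq> A'" "A' \<subseteq> B" for A A'
    by (rule N_indicator_mono[OF mem[OF that(2,4)] that(1,3)])
  have empty: "?n {} = 0" using N_indicator_eq_0_iff[OF mem, of "{}"] by simp
  \<comment> \<open>\<open>?Q A D\<close>: the set \<open>D\<close> may be added to \<open>A\<close>.  \<open>?R\<close>: the step from \<open>A\<close> to \<open>A'\<close> adds a set whose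
    norm is at least half of what any admissible set has.\<close>
  let ?P = "\<lambda>A. A \<in> sets M \<and> A \<subseteq> B \<and> ?n A \<le> \<theta>"
  let ?Q = "\<lambda>A D. D \<in> sets M \<and> D \<subseteq> B - A \<and> ?n (A \<union> D) \<le> \<theta>"
  let ?R = "\<lambda>A A'. A \<subseteq> A' \<and> (\<forall>D. ?Q A D \<longrightarrow> ?n D \<le> 2 * ?n (A' - A))"
  have step: "\<exists>A'. ?P A' \<and> ?R A A'" if A: "?P A" for A
  proof -
    define s where "s = (SUP D\<in>{D. ?Q A D}. ?n D)"
    have bdd: "bdd_above (?n ` {D. ?Q A D})"
      by (rule bdd_aboveI[of _ "?n B"]) (use mono B(1) in auto)
    have Q0: "?Q A {}" using A by simp
    have le_s: "?n D \<le> s" if "?Q A D" for D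
      unfolding s_def by (rule cSUP_upper[OF _ bdd]) (use that in simp)
    have "\<exists>D. ?Q A D \<and> s \<le> 2 * ?n D"
    proof (cases "s \<le> 0")
      case True
      then show ?thesis using Q0 empty by (intro exI[of _ "{}"]) simp
    next
      case False
      then have "s / 2 < s" by simp
      then have "\<exists>D\<in>{D. ?Q A D}. s / 2 < ?n D"
        unfolding s_def using less_cSUP_iff[OF _ bdd] Q0 by blast
      then show ?thesis by auto
    qed
    then obtain D where D: "?Q A D" "s \<le> 2 * ?n D" by blast
    have "A \<union> D - A = D" using D by blast
    then have "?P (A \<union> D) \<and> ?R A (A \<union> D)" using A D le_s by (auto intro: order_trans)
    then show ?thesis by blast
  qed
  have "\<exists>A. \<forall>n::nat. ?P (A n) \<and> ?R (A n) (A (Suc n))"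
  proof (rule dependent_nat_choice)
    show "\<exists>A. ?P A" using \<theta> empty by (intro exI[of _ "{}"]) simp
  qed (rule step)
  then obtain A where A: "\<forall>n::nat. ?P (A n) \<and> ?R (A n) (A (Suc n))" ..
  have P: "?P (A n)" and R: "?R (A n) (A (Suc n))" for n using spec[OF A, of n] by blast+
  have inc: "incseq A" using R by (intro incseq_SucI) blast
  define U where "U = (\<Union>n. A n)"
  have U: "U \<in> sets M" "U \<subseteq> B" using P unfolding U_def by blast+
  have U_le: "?n U \<le> \<theta>"
  proof (rule LIMSEQ_le_const2)
    show "(\<lambda>n. ?n (A n)) \<longlonglongrightarrow> ?n U"
      by (rule fatou_sets_tendsto[OF inc _ mem _ U(1), where c = \<theta>]) (use P U_def in auto)
  qed (use P in blast)
  have disj: "disjoint_family (\<lambda>n. A (Suc n) - A n)"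
  proof -
    have "(A (Suc m) - A m) \<inter> (A (Suc n) - A n) = {}" if "m < n" for m n
      using incseqD[OF inc, of "Suc m" n] that by auto
    then show ?thesis unfolding disjoint_family_on_def by (metis Int_commute linorder_neqE_nat)
  qed
  have incr0: "(\<lambda>n. ?n (A (Suc n) - A n)) \<longlonglongrightarrow> 0"
    by (rule disjoint_indicators_tendsto_zero[OF no_copy disj _ _ B(2)]) (use P in auto)
  have maximal: "emeasure M D = 0" if D: "D \<in> sets M" "D \<subseteq> B - U" "?n (U \<union> D) \<le> \<theta>" for D
  proof -
    have "?n D \<le> 2 * ?n (A (Suc n) - A n)" for n
    proof -
      have "?n (A n \<union> D) \<le> ?n (U \<union> D)"
        by (rule mono) (use P U D U_def in auto)
      then have "?Q (A n) D" using D U_def by auto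
      then show ?thesis using R by blast
    qed
    then have "?n D \<le> 0"
      using LIMSEQ_le_const[OF tendsto_mult_left[OF incr0, of 2], of "?n D"] by auto
    moreover have DE: "(indicator D :: 'a \<Rightarrow> real) \<in> E" using mem D by blast
    ultimately show ?thesis using N_nonneg[OF DE] N_indicator_eq_0_iff[OF DE D(1)] by simp
  qed
  have rest: "emeasure M (B - U) \<noteq> 0"
  proof
    assume "emeasure M (B - U) = 0"
    then have "B - U \<in> null_sets M" using B U by auto
    then have "AE t in M. t \<notin> B - U" by (rule AE_not_in)
    then have "AE t in M. \<bar>indicator B t :: real\<bar> \<le> \<bar>indicator U t\<bar>"
      by eventually_elim (auto simp: indicator_def)
    then have "?n B \<le> ?n U" by (rule N_mono[OF indicator_measurable[OF B(1)] mem[OF U]])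
    then show False using U_le \<theta> by simp
  qed
  obtain D :: "nat \<Rightarrow> 'a set" where D: "disjoint_family D"
    "\<And>n. D n \<in> sets M" "\<And>n. D n \<subseteq> B - U" "\<And>n. emeasure M (D n) \<noteq> 0"
    using nonatomic_disjoint_sequence[OF na _ rest] B U by blast
  define T where "T j = (\<Union>n\<in>{j..}. D n)" for j
  have T: "T j \<in> sets M" "T j \<subseteq> B - U" "D j \<subseteq> T j" for j
    unfolding T_def using D by (auto intro!: sets.countable_UN'')
  have "(\<Inter>j. T j) = {}"
  proof -
    have "t \<notin> T (Suc n)" if "t \<in> D n" for t n
    proof
      assume "t \<in> T (Suc n)"
      then obtain m where m: "Suc n \<le> m" "t \<in> D m" unfolding T_def by blast
      then have "D m \<inter> D n = {}" by (intro disjoint_family_onD[OF D(1)]) auto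
      then show False using m that by blast
    qed
    then have "t \<notin> (\<Inter>j. T j)" for t
      unfolding T_def by (metis INT_E UNIV_I UN_E)
    then show ?thesis by blast
  qed
  moreover have "decseq T"
    unfolding decseq_def T_def by (intro allI impI UN_mono) auto
  ultimately have T0: "(\<lambda>j. ?n (T j)) \<longlonglongrightarrow> 0"
    by (intro order_continuous_at_empty[OF no_copy _ _ _ _ B(2)]) (use T in auto)
  have "\<theta> \<le> modulus * (?n U + ?n (T j))" for j
  proof -
    have "emeasure M (T j) \<noteq> 0" using emeasure_mono[OF T(3,1), of j] D(4)[of j] by auto
    then have "\<theta> < ?n (U \<union> T j)" using maximal[OF T(1,2), of j] by force
    also have "\<dots> \<le> modulus * (?n U + ?n (T j))"
      by (rule N_indicator_Un) (use mem T U in auto)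
    finally show ?thesis by simp
  qed
  moreover have "(\<lambda>j. modulus * (?n U + ?n (T j))) \<longlonglongrightarrow> modulus * (?n U + 0)"
    by (intro tendsto_intros T0)
  ultimately have "\<theta> \<le> modulus * ?n U"
    using LIMSEQ_le_const[of _ "modulus * (?n U + 0)" \<theta>] by fastforce
  then show ?thesis using that U U_le by blast
qed

text \<open>
  Along an exhaustion \<open>S\<close> the norms of \<open>S k - S j\<close> are unbounded in \<open>k\<close> for each \<open>j\<close>: otherwise the
  norms of \<open>S k\<close> would be bounded, and the Fatou property would put the constant 1 into \<open>E\<close>.
\<close>

lemma disjoint_indicators_of_large_norm:
  fixes \<theta> :: "nat \<Rightarrow> real"
  assumes one: "(\<lambda>t. 1) \<notin> E"
  obtains B where "disjoint_family B" "\<And>n. B n \<in> sets M"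
    "\<And>n. (indicator (B n) :: 'a \<Rightarrow> real) \<in> E" "\<And>n. \<theta> n < N (indicator (B n))"
proof -
  let ?n = "\<lambda>A. N (indicator A)"
  obtain S :: "nat \<Rightarrow> 'a set" where S: "incseq S" "\<And>k. S k \<in> sets M"
    "\<And>k. (indicator (S k) :: 'a \<Rightarrow> real) \<in> E" "AE t in M. \<exists>k. t \<in> S k"
    by (rule exhaustion) blast
  have dm: "(indicator (S k - S j) :: 'a \<Rightarrow> real) \<in> E" for k j
    by (rule indicator_subset_mem[OF S(3)[of k]]) (use S(2) in auto)
  have large: "\<exists>k\<ge>j. c < ?n (S k - S j)" for j c
  proof (rule ccontr)
    assume "\<not> ?thesis"
    then have le: "?n (S k - S j) \<le> c" if "j \<le> k" for k using that by (meson not_less)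
    have "?n (S k) \<le> modulus * (?n (S j) + c)" for k
    proof -
      let ?k = "max j k"
      have "S k \<subseteq> S j \<union> (S ?k - S j)" using incseqD[OF S(1), of k ?k] by auto
      then have "?n (S k) \<le> ?n (S j \<union> (S ?k - S j))"
        by (intro N_indicator_mono indicator_Un_mem S dm) (use S(2) in auto)
      also have "\<dots> \<le> modulus * (?n (S j) + ?n (S ?k - S j))"
        by (rule N_indicator_Un) (use S dm in auto)
      also have "\<dots> \<le> modulus * (?n (S j) + c)"
        using modulus_ge_1 le[of ?k] by (intro mult_left_mono add_left_mono) auto
      finally show ?thesis .
    qed
    then have mem: "(indicator (space M) :: 'a \<Rightarrow> real) \<in> E"
      by (intro fatou_sets_mem[OF S(1-3)]) (use S(4) AE_space[of M] in auto)
    have "(\<lambda>t. 1) \<in> E"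
      by (rule ideal_mem[OF _ mem]) (auto intro!: AE_I2)
    then show False using one by blast
  qed
  have "\<exists>r. \<forall>k::nat. True \<and> (r k \<le> r (Suc k) \<and> \<theta> k < ?n (S (r (Suc k)) - S (r k)))"
    by (rule dependent_nat_choice) (use large in auto)
  then obtain r :: "nat \<Rightarrow> nat" where r: "\<And>k. r k \<le> r (Suc k)"
    "\<And>k. \<theta> k < ?n (S (r (Suc k)) - S (r k))" by blast
  have "(S (r (Suc m)) - S (r m)) \<inter> (S (r (Suc n)) - S (r n)) = {}" if "m < n" for m n
  proof -
    have "r (Suc m) \<le> r n" by (rule lift_Suc_mono_le[of r]) (use r that in auto)
    then show ?thesis using incseqD[OF S(1)] by blast
  qed
  then have "disjoint_family (\<lambda>k. S (r (Suc k)) - S (r k))"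
    unfolding disjoint_family_on_def by (metis Int_commute linorder_neqE_nat)
  then show ?thesis by (rule that) (use S(2) dm r(2) in auto)
qed

end

section \<open>The modular and the quasi-norm of \<open>E\<^sub>\<phi>\<close>\<close>

lemma borel_measurable_mono_ennreal:
  fixes f :: "real \<Rightarrow> ennreal"
  assumes "mono f"
  shows "f \<in> borel_measurable borel"
proof (rule borel_measurableI_greater)
  fix y
  have "is_interval {u. y < f u}"
    unfolding is_interval_1 using assms by (auto simp: mono_def intro: less_le_trans)
  then show "{u \<in> space borel. y < f u} \<in> sets borel" by (simp add: real_interval_borel_measurable)
qed

lemma ex_small_powr:
  fixes p d :: real
  assumes "0 < p" "0 < d"
  obtains l where "0 < l" "l \<le> 1" "l powr p \<le> d"
proof
  have "min 1 (d powr (1 / p)) powr p \<le> (d powr (1 / p)) powr p"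
    using assms by (intro powr_mono2) auto
  also have "\<dots> = d" using assms by (simp add: powr_powr)
  finally show "min 1 (d powr (1 / p)) powr p \<le> d" .
qed (use assms in auto)

locale orlicz_setting = fatou_ideal +
  fixes \<phi> :: "real \<Rightarrow> ennreal"
  assumes orlicz: "orlicz_function \<phi>"
begin

abbreviation modular :: "('a \<Rightarrow> real) \<Rightarrow> ennreal" where
  "modular \<equiv> orlicz_modular M E N \<phi>"

abbreviation E\<phi> :: "('a \<Rightarrow> real) set" where
  "E\<phi> \<equiv> orlicz_space M E N \<phi>"

abbreviation norm\<phi> :: "('a \<Rightarrow> real) \<Rightarrow> real" where
  "norm\<phi> \<equiv> orlicz_norm M E N \<phi>"

lemma phi_mono: "0 \<le> u \<Longrightarrow> u \<le> v \<Longrightarrow> \<phi> u \<le> \<phi> v"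
  using orlicz unfolding orlicz_function_def by (auto simp: mono_on_def)

lemma phi_zero: "\<phi> 0 = 0"
  using orlicz unfolding orlicz_function_def by blast

lemma phi_exceeds:
  assumes "y < top"
  obtains u where "0 < u" "y < \<phi> u"
proof -
  have "(\<phi> \<longlongrightarrow> \<infinity>) at_top" using orlicz unfolding orlicz_function_def by blast
  then have "\<forall>\<^sub>F u in at_top. y < \<phi> u" by (rule order_tendstoD) (use assms in simp)
  then have "\<forall>\<^sub>F u in at_top. 0 < u \<and> y < \<phi> u" using eventually_gt_at_top[of 0] by eventually_elim simp
  from eventually_happens[OF this] show ?thesis using that by auto
qed

lemma phi_measurable:
  assumes "x \<in> borel_measurable M"
  shows "(\<lambda>t. \<phi> \<bar>x t\<bar>) \<in> borel_measurable M"
proof -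
  have "mono (\<lambda>u. \<phi> (max 0 u))" by (intro monoI phi_mono) auto
  then have "(\<lambda>u. \<phi> (max 0 u)) \<in> borel_measurable borel" by (rule borel_measurable_mono_ennreal)
  moreover have "(\<lambda>t. \<bar>x t\<bar>) \<in> borel_measurable M" using assms by measurable
  ultimately have "(\<lambda>t. \<phi> (max 0 \<bar>x t\<bar>)) \<in> borel_measurable M" by (rule measurable_compose[rotated])
  then show ?thesis by simp
qed

lemma modular_le_of_dominated:
  assumes x: "x \<in> borel_measurable M" and y: "y \<in> E" and le: "AE t in M. \<phi> \<bar>x t\<bar> \<le> ennreal (y t)"
  shows "modular x \<le> ennreal (N y)"
proof -
  have fin: "AE t in M. \<phi> \<bar>x t\<bar> < \<infinity>" using le by eventually_elim (auto intro: le_less_trans)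
  have "AE t in M. \<bar>enn2real (\<phi> \<bar>x t\<bar>)\<bar> \<le> \<bar>y t\<bar>"
    using le
  proof eventually_elim
    case (elim t)
    then have "\<phi> \<bar>x t\<bar> \<le> ennreal \<bar>y t\<bar>" by (meson abs_ge_self ennreal_leI order_trans)
    then show ?case by (simp add: enn2real_leI)
  qed
  moreover have "(\<lambda>t. enn2real (\<phi> \<bar>x t\<bar>)) \<in> borel_measurable M"
    using phi_measurable[OF x] by measurable
  ultimately have "(\<lambda>t. enn2real (\<phi> \<bar>x t\<bar>)) \<in> E" "N (\<lambda>t. enn2real (\<phi> \<bar>x t\<bar>)) \<le> N y"
    using ideal[OF _ y] by blast+
  then show ?thesis using fin unfolding orlicz_modular_def by (simp add: ennreal_leI)
qed

lemma modular_finiteE: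
  assumes "modular x < \<infinity>"
  obtains y where "y \<in> E" "\<And>t. 0 \<le> y t" "AE t in M. \<phi> \<bar>x t\<bar> = ennreal (y t)"
    "modular x = ennreal (N y)" "y = (\<lambda>t. enn2real (\<phi> \<bar>x t\<bar>))"
proof -
  have *: "AE t in M. \<phi> \<bar>x t\<bar> < \<infinity>" "(\<lambda>t. enn2real (\<phi> \<bar>x t\<bar>)) \<in> E"
    "modular x = ennreal (N (\<lambda>t. enn2real (\<phi> \<bar>x t\<bar>)))"
    using assms unfolding orlicz_modular_def by (auto split: if_splits)
  show ?thesis
    by (rule that[OF *(2) _ _ *(3) refl]) (use *(1) in \<open>auto elim: eventually_mono\<close>)
qed

lemma modular_leE:
  assumes "modular x \<le> ennreal R" "0 \<le> R"
  obtains y where "y \<in> E" "\<And>t. 0 \<le> y t" "AE t in M. \<phi> \<bar>x t\<bar> = ennreal (y t)"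
    "N y \<le> R" "y = (\<lambda>t. enn2real (\<phi> \<bar>x t\<bar>))"
proof -
  have "modular x < \<infinity>" using assms(1) by (auto intro: le_less_trans)
  then obtain y where y: "y \<in> E" "\<And>t. 0 \<le> y t" "AE t in M. \<phi> \<bar>x t\<bar> = ennreal (y t)"
    "modular x = ennreal (N y)" "y = (\<lambda>t. enn2real (\<phi> \<bar>x t\<bar>))" by (rule modular_finiteE) blast
  show ?thesis using that[OF y(1-3) _ y(5)] y(4) assms by (simp add: ennreal_le_iff)
qed

lemma modular_mono:
  assumes x: "x \<in> borel_measurable M" and le: "AE t in M. \<bar>x t\<bar> \<le> \<bar>y t\<bar>"
  shows "modular x \<le> modular y"
proof (cases "modular y < \<infinity>")
  case True
  then obtain z where z: "z \<in> E" "AE t in M. \<phi> \<bar>y t\<bar> = ennreal (z t)" "modular y = ennreal (N z)"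
    by (rule modular_finiteE) blast
  have "AE t in M. \<phi> \<bar>x t\<bar> \<le> ennreal (z t)"
    using le z(2) by eventually_elim (metis abs_ge_zero phi_mono)
  then show ?thesis using modular_le_of_dominated[OF x z(1)] z(3) by simp
qed (simp add: less_top[symmetric])

text \<open>
  The form in which positivity of the lower index is used; it does not depend on the variant.
\<close>

definition modular_shrinks :: bool where
  "modular_shrinks \<longleftrightarrow>
     (\<forall>R>0. \<forall>\<epsilon>>0. \<exists>l>0. \<forall>x\<in>borel_measurable M.
        modular x \<le> ennreal R \<longrightarrow> modular (\<lambda>t. l * x t) \<le> ennreal \<epsilon>)"

lemma modular_shrinks_of_power_bound:
  assumes bd: "lower_power_bound \<phi> U p" and p: "0 < p" and R: "0 < R" and e: "0 < \<epsilon>"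
  obtains l where "0 < l" and "\<And>x y. x \<in> borel_measurable M \<Longrightarrow> y \<in> E \<Longrightarrow> N y \<le> R \<Longrightarrow>
     AE t in M. \<bar>x t\<bar> \<in> U \<and> \<phi> \<bar>x t\<bar> \<le> ennreal (y t) \<Longrightarrow> modular (\<lambda>t. l * x t) \<le> ennreal \<epsilon>"
proof -
  obtain K where K: "1 \<le> K"
    "\<And>u a. u \<in> U \<Longrightarrow> 0 < a \<Longrightarrow> a \<le> 1 \<Longrightarrow> \<phi> (a * u) \<le> ennreal (K * a powr p) * \<phi> u"
    using bd unfolding lower_power_bound_def by auto
  obtain l where l: "0 < l" "l \<le> 1" "l powr p \<le> \<epsilon> / (K * R)"
    using ex_small_powr[OF p, of "\<epsilon> / (K * R)"] K R e by auto
  show ?thesis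
  proof (rule that[OF l(1)])
    fix x y
    assume x: "x \<in> borel_measurable M" and y: "y \<in> E" "N y \<le> R"
      and xy: "AE t in M. \<bar>x t\<bar> \<in> U \<and> \<phi> \<bar>x t\<bar> \<le> ennreal (y t)"
    let ?y = "\<lambda>t. (K * l powr p) * y t"
    have "modular (\<lambda>t. l * x t) \<le> ennreal (N ?y)"
    proof (rule modular_le_of_dominated[OF _ scale_mem[OF y(1)]])
      show "(\<lambda>t. l * x t) \<in> borel_measurable M" using x by measurable
      show "AE t in M. \<phi> \<bar>l * x t\<bar> \<le> ennreal (?y t)"
        using xy
      proof eventually_elim
        case (elim t)
        have "\<phi> \<bar>l * x t\<bar> \<le> ennreal (K * l powr p) * \<phi> \<bar>x t\<bar>"
          using K(2)[of "\<bar>x t\<bar>" l] elim l by (simp add: abs_mult)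
        also have "\<dots> \<le> ennreal (K * l powr p) * ennreal (y t)"
          using elim by (intro mult_left_mono) auto
        also have "\<dots> = ennreal (?y t)" using K(1) by (simp add: ennreal_mult')
        finally show ?case .
      qed
    qed
    moreover have "N ?y \<le> \<epsilon>"
    proof -
      have "N ?y = K * l powr p * N y" using N_scale[OF y(1), of "K * l powr p"] K(1) by simp
      also have "\<dots> \<le> K * (\<epsilon> / (K * R)) * R"
        using K(1) l R e y N_nonneg[OF y(1)] by (intro mult_mono) auto
      also have "\<dots> = \<epsilon>" using K(1) R by simp
      finally show ?thesis .
    qed
    ultimately show "modular (\<lambda>t. l * x t) \<le> ennreal \<epsilon>" by (meson ennreal_leI order_trans)
  qed
qed

lemma phi_small_near_zero:
  assumes "0 < d"
  obtains u where "0 < u" "\<phi> u < ennreal d"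
proof -
  have "(\<phi> \<longlongrightarrow> \<phi> 0) (at_right 0)"
    using orlicz unfolding orlicz_function_def continuous_within by blast
  then have "\<forall>\<^sub>F u in at_right 0. \<phi> u < ennreal d"
    by (rule order_tendstoD) (use assms phi_zero in simp)
  then obtain b where "0 < b" "\<And>u. 0 < u \<Longrightarrow> u < b \<Longrightarrow> \<phi> u < ennreal d"
    unfolding eventually_at_right_field by blast
  then show ?thesis using that[of "b / 2"] by simp
qed

lemma constant_mem:
  assumes "L_infinity M \<subseteq> E"
  shows "(\<lambda>t. c) \<in> E"
proof -
  have "(\<lambda>t. c) \<in> L_infinity M" unfolding L_infinity_def by (auto intro!: exI[of _ "\<bar>c\<bar>"])
  then show ?thesis using assms by blast
qed

lemma positive_index_shrinks_everywhere:
  assumes "lower_index Everywhere \<phi> > 0"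
  shows "modular_shrinks"
  unfolding modular_shrinks_def
proof (intro allI impI)
  fix R \<epsilon> :: real
  assume R: "0 < R" and e: "0 < \<epsilon>"
  obtain p where p: "0 < p" "lower_power_bound \<phi> {0..} p"
    using assms unfolding lower_index_def by (auto simp: less_SUP_iff)
  obtain l where l: "0 < l" "\<And>x y. x \<in> borel_measurable M \<Longrightarrow> y \<in> E \<Longrightarrow> N y \<le> R \<Longrightarrow>
     AE t in M. \<bar>x t\<bar> \<in> {0..} \<and> \<phi> \<bar>x t\<bar> \<le> ennreal (y t) \<Longrightarrow> modular (\<lambda>t. l * x t) \<le> ennreal \<epsilon>"
    using modular_shrinks_of_power_bound[OF p(2,1) R e] by blast
  show "\<exists>l>0. \<forall>x\<in>borel_measurable M. modular x \<le> ennreal R \<longrightarrow> modular (\<lambda>t. l * x t) \<le> ennreal \<epsilon>"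
  proof (intro exI[of _ l] conjI ballI impI)
    show "0 < l" by (rule l(1))
  next
    fix x assume x: "x \<in> borel_measurable M" "modular x \<le> ennreal R"
    obtain y where y: "y \<in> E" "AE t in M. \<phi> \<bar>x t\<bar> = ennreal (y t)" "N y \<le> R"
      by (rule modular_leE[OF x(2) less_imp_le[OF R]]) blast
    have "AE t in M. \<bar>x t\<bar> \<in> {0..} \<and> \<phi> \<bar>x t\<bar> \<le> ennreal (y t)"
      using y(2) by eventually_elim simp
    then show "modular (\<lambda>t. l * x t) \<le> ennreal \<epsilon>" by (rule l(2)[OF x(1) y(1,3)])
  qed
qed

text \<open>
  Where \<open>\<bar>x t\<bar>\<close> is at least \<open>u0\<close> the power bound applies.  Elsewhere \<open>\<phi>(l * \<bar>x t\<bar>)\<close> is at most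
  \<open>\<phi>(l * u0)\<close>, a constant that tends to zero with \<open>l\<close> by right continuity at 0, and constants belong
  to \<open>E\<close>.  Each part gets the share \<open>\<epsilon> / (2 * modulus)\<close> of the bound.
\<close>

lemma positive_index_shrinks_at_infinity:
  assumes "lower_index At_Infinity \<phi> > 0" and LE: "L_infinity M \<subseteq> E"
  shows "modular_shrinks"
  unfolding modular_shrinks_def
proof (intro allI impI)
  fix R \<epsilon> :: real
  assume R: "0 < R" and e: "0 < \<epsilon>"
  obtain p u0 where p: "0 < p" "lower_power_bound \<phi> {u0..} p" "0 < u0"
    using assms unfolding lower_index_def by (auto simp: less_SUP_iff)
  have one: "(\<lambda>t. 1) \<in> E" by (rule constant_mem[OF LE])
  define e2 where "e2 = \<epsilon> / (2 * modulus)"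
  have e2: "0 < e2" using e modulus_ge_1 unfolding e2_def by simp
  obtain K where K: "1 \<le> K"
    "\<And>u a. u0 \<le> u \<Longrightarrow> 0 < a \<Longrightarrow> a \<le> 1 \<Longrightarrow> \<phi> (a * u) \<le> ennreal (K * a powr p) * \<phi> u"
    using p(2) unfolding lower_power_bound_def by auto
  define d where "d = e2 / (N (\<lambda>t. 1) + 1)"
  have d: "0 < d" "d * N (\<lambda>t. 1) \<le> e2"
    using e2 N_nonneg[OF one] unfolding d_def by (auto simp: field_simps)
  obtain u1 where u1: "0 < u1" "\<phi> u1 < ennreal d" using phi_small_near_zero[OF d(1)] by blast
  obtain l0 where l0: "0 < l0" "l0 \<le> 1" "l0 powr p \<le> e2 / (K * R)"
    using ex_small_powr[OF p(1), of "e2 / (K * R)"] K R e2 by auto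
  define l where "l = min l0 (u1 / u0)"
  have l: "0 < l" "l \<le> 1" "l \<le> u1 / u0" using l0 u1 p unfolding l_def by auto
  have lu: "l * u0 \<le> u1" using l(3) p(3) by (simp add: field_simps)
  have lp: "l powr p \<le> e2 / (K * R)"
    using powr_mono2[of p l l0] l l0 p(1) unfolding l_def by auto
  show "\<exists>l>0. \<forall>x\<in>borel_measurable M. modular x \<le> ennreal R \<longrightarrow> modular (\<lambda>t. l * x t) \<le> ennreal \<epsilon>"
  proof (intro exI[of _ l] conjI ballI impI)
    show "0 < l" by (rule l(1))
  next
    fix x assume x: "x \<in> borel_measurable M" "modular x \<le> ennreal R"
    obtain y where y: "y \<in> E" "\<And>t. 0 \<le> y t" "AE t in M. \<phi> \<bar>x t\<bar> = ennreal (y t)" "N y \<le> R"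
      by (rule modular_leE[OF x(2) less_imp_le[OF R]]) blast
    let ?y = "\<lambda>t. (K * l powr p) * y t" and ?d = "\<lambda>t. d * 1"
    have y': "?y \<in> E" by (rule scale_mem[OF y(1)])
    have d': "?d \<in> E" by (rule scale_mem[OF one])
    have "modular (\<lambda>t. l * x t) \<le> ennreal (N (\<lambda>t. ?y t + ?d t))"
    proof (rule modular_le_of_dominated[OF _ add_mem[OF y' d']])
      show "(\<lambda>t. l * x t) \<in> borel_measurable M" using x by measurable
      show "AE t in M. \<phi> \<bar>l * x t\<bar> \<le> ennreal (?y t + ?d t)"
        using y(3)
      proof eventually_elim
        case (elim t)
        have nn: "0 \<le> ?y t" using K(1) y(2)[of t] by simp
        show ?case
        proof (cases "u0 \<le> \<bar>x t\<bar>")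
          case True
          have "\<phi> \<bar>l * x t\<bar> \<le> ennreal (K * l powr p) * \<phi> \<bar>x t\<bar>"
            using K(2)[of "\<bar>x t\<bar>" l] True l by (simp add: abs_mult)
          also have "\<dots> = ennreal (?y t)" using K(1) elim by (simp add: ennreal_mult')
          also have "\<dots> \<le> ennreal (?y t + ?d t)" using d(1) by (intro ennreal_leI) simp
          finally show ?thesis .
        next
          case False
          then have "l * \<bar>x t\<bar> \<le> l * u0" using l by (intro mult_left_mono) auto
          moreover have "\<bar>l * x t\<bar> = l * \<bar>x t\<bar>" using l by (simp add: abs_mult)
          ultimately have "\<bar>l * x t\<bar> \<le> u1" using lu by linarith
          then have "\<phi> \<bar>l * x t\<bar> \<le> \<phi> u1" by (intro phi_mono) auto
          also have "\<dots> \<le> ennreal (?y t + ?d t)"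
            using u1(2) nn by (intro order_trans[OF less_imp_le[OF u1(2)]] ennreal_leI) simp
          finally show ?thesis .
        qed
      qed
    qed
    moreover have "N (\<lambda>t. ?y t + ?d t) \<le> \<epsilon>"
    proof -
      have "N ?y = K * l powr p * N y" using N_scale[OF y(1), of "K * l powr p"] K(1) by simp
      also have "\<dots> \<le> K * (e2 / (K * R)) * R"
        using K(1) lp R e2 y N_nonneg[OF y(1)] by (intro mult_mono) auto
      also have "\<dots> = e2" using K(1) R by simp
      finally have "N ?y \<le> e2" .
      moreover have "N ?d \<le> e2" using N_scale[OF one, of d] d by simp
      ultimately have "modulus * (N ?y + N ?d) \<le> modulus * (e2 + e2)"
        using modulus_ge_1 by (intro mult_left_mono) auto
      also have "\<dots> = \<epsilon>" using modulus_ge_1 unfolding e2_def by (simp add: field_simps)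
      finally show ?thesis using quasi_triangle[OF y' d'] by linarith
    qed
    ultimately show "modular (\<lambda>t. l * x t) \<le> ennreal \<epsilon>" by (meson ennreal_leI order_trans)
  qed
qed

text \<open>
  On \<open>modular x \<le> R\<close> the functions \<open>\<phi>(\<bar>x\<bar>)\<close>, hence also \<open>x\<close> itself, are uniformly bounded, because the
  norm of \<open>E\<close> dominates the supremum norm.  A preliminary scaling by \<open>k\<close> moves \<open>x\<close> into \<open>{0..u0}\<close>,
  where the power bound holds.
\<close>

lemma positive_index_shrinks_at_zero:
  assumes "lower_index At_Zero \<phi> > 0" and EL: "E \<subseteq> L_infinity M"
  shows "modular_shrinks"
  unfolding modular_shrinks_def
proof (intro allI impI)
  fix R \<epsilon> :: real
  assume R: "0 < R" and e: "0 < \<epsilon>"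
  obtain p u0 where p: "0 < p" "lower_power_bound \<phi> {0..u0} p" "0 < u0"
    using assms unfolding lower_index_def by (auto simp: less_SUP_iff)
  obtain B where B: "0 < B" "\<And>x. x \<in> E \<Longrightarrow> AE t in M. \<bar>x t\<bar> \<le> B * N x"
    using sup_norm_bound[OF EL] by blast
  obtain u1 where u1: "0 < u1" "ennreal (B * R) < \<phi> u1" using phi_exceeds[of "ennreal (B * R)"] by auto
  obtain l where l: "0 < l" "\<And>x y. x \<in> borel_measurable M \<Longrightarrow> y \<in> E \<Longrightarrow> N y \<le> R \<Longrightarrow>
     AE t in M. \<bar>x t\<bar> \<in> {0..u0} \<and> \<phi> \<bar>x t\<bar> \<le> ennreal (y t) \<Longrightarrow> modular (\<lambda>t. l * x t) \<le> ennreal \<epsilon>"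
    using modular_shrinks_of_power_bound[OF p(2,1) R e] by blast
  define k where "k = min 1 (u0 / u1)"
  have k: "0 < k" "k \<le> 1" "k * u1 \<le> u0" using p u1 unfolding k_def by (auto simp: min_def field_simps)
  show "\<exists>l>0. \<forall>x\<in>borel_measurable M. modular x \<le> ennreal R \<longrightarrow> modular (\<lambda>t. l * x t) \<le> ennreal \<epsilon>"
  proof (intro exI[of _ "l * k"] conjI ballI impI)
    show "0 < l * k" by (rule mult_pos_pos[OF l(1) k(1)])
  next
    fix x assume x: "x \<in> borel_measurable M" "modular x \<le> ennreal R"
    obtain y where y: "y \<in> E" "AE t in M. \<phi> \<bar>x t\<bar> = ennreal (y t)" "N y \<le> R"
      by (rule modular_leE[OF x(2) less_imp_le[OF R]]) blast
    have BN: "B * N y \<le> B * R" using B y by simp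
    have "AE t in M. \<bar>k * x t\<bar> \<in> {0..u0} \<and> \<phi> \<bar>k * x t\<bar> \<le> ennreal (y t)"
      using y(2) B(2)[OF y(1)]
    proof eventually_elim
      case (elim t)
      have "\<phi> \<bar>x t\<bar> \<le> ennreal (B * R)" using elim BN by (simp add: ennreal_leI)
      then have "\<bar>x t\<bar> \<le> u1" using u1 phi_mono[of u1 "\<bar>x t\<bar>"] by (meson leD less_imp_le not_le order_trans)
      then have "k * \<bar>x t\<bar> \<le> k * u1" using k by simp
      moreover have "\<bar>k * x t\<bar> = k * \<bar>x t\<bar>" using k by (simp add: abs_mult)
      ultimately have "\<bar>k * x t\<bar> \<le> u0" using k(3) by linarith
      moreover have "\<bar>k * x t\<bar> \<le> \<bar>x t\<bar>" using k by (simp add: abs_mult mult_left_le_one_le)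
      then have "\<phi> \<bar>k * x t\<bar> \<le> \<phi> \<bar>x t\<bar>" by (intro phi_mono) auto
      ultimately show ?case using elim by simp
    qed
    moreover have "(\<lambda>t. k * x t) \<in> borel_measurable M" using x(1) by measurable
    ultimately have "modular (\<lambda>t. l * (k * x t)) \<le> ennreal \<epsilon>" by (intro l(2)[OF _ y(1,3)])
    then show "modular (\<lambda>t. l * k * x t) \<le> ennreal \<epsilon>" by (simp add: mult.assoc)
  qed
qed

lemma positive_index_shrinks:
  assumes "applicable M E v" "lower_index v \<phi> > 0"
  shows "modular_shrinks"
proof (cases v)
  case Everywhere
  then show ?thesis using assms(2) positive_index_shrinks_everywhere by simp
next
  case At_Infinity
  then show ?thesis using assms positive_index_shrinks_at_infinity by (simp add: applicable_def)
next
  case At_Zero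
  then show ?thesis using assms positive_index_shrinks_at_zero by (simp add: applicable_def)
qed

lemma orlicz_space_measurable: "x \<in> E\<phi> \<Longrightarrow> x \<in> borel_measurable M"
  unfolding orlicz_space_def by blast

text \<open>
  The infimum defining the quasi-norm is taken over a nonempty set; without this it would have no
  useful value.
\<close>

lemma orlicz_unit_nonempty:
  assumes shr: "modular_shrinks" and x: "x \<in> E\<phi>"
  obtains l where "0 < l" "modular (\<lambda>t. x t / l) \<le> 1"
proof -
  obtain k where k: "0 < k" "modular (\<lambda>t. k * x t) < \<infinity>" and m: "x \<in> borel_measurable M"
    using x unfolding orlicz_space_def by auto
  define R where "R = enn2real (modular (\<lambda>t. k * x t)) + 1"
  have R: "0 < R" "modular (\<lambda>t. k * x t) \<le> ennreal R"
    using k(2) unfolding R_def by (auto simp: add_nonneg_pos intro: enn2real_le)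
  obtain l where l: "0 < l" "\<And>y. y \<in> borel_measurable M \<Longrightarrow> modular y \<le> ennreal R \<Longrightarrow>
      modular (\<lambda>t. l * y t) \<le> ennreal 1"
    using shr R(1) unfolding modular_shrinks_def by (metis zero_less_one)
  have "modular (\<lambda>t. l * (k * x t)) \<le> ennreal 1" by (rule l(2)) (use m R in auto)
  moreover have "(\<lambda>t. l * (k * x t)) = (\<lambda>t. x t / (1 / (l * k)))" by (auto simp: mult_ac)
  ultimately show ?thesis using that[of "1 / (l * k)"] l(1) k(1) by simp
qed

lemma orlicz_norm_le:
  assumes "0 < l" "modular (\<lambda>t. x t / l) \<le> 1"
  shows "norm\<phi> x \<le> l"
  unfolding orlicz_norm_def using assms by (intro cInf_lower bdd_belowI[of _ 0]) auto

lemma orlicz_norm_ge: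
  assumes shr: "modular_shrinks" and x: "x \<in> E\<phi>"
    and large: "\<And>l. 0 < l \<Longrightarrow> modular (\<lambda>t. x t / l) \<le> 1 \<Longrightarrow> c \<le> l"
  shows "c \<le> norm\<phi> x"
  unfolding orlicz_norm_def
  using orlicz_unit_nonempty[OF shr x] large by (intro cInf_greatest) auto

lemma orlicz_norm_ge_of_modular:
  assumes shr: "modular_shrinks" and x: "x \<in> E\<phi>" and c: "0 < c" "\<not> modular (\<lambda>t. x t / c) \<le> 1"
  shows "c \<le> norm\<phi> x"
proof (rule orlicz_norm_ge[OF shr x])
  fix l assume l: "0 < l" "modular (\<lambda>t. x t / l) \<le> 1"
  show "c \<le> l"
  proof (rule ccontr)
    assume "\<not> c \<le> l"
    then have "\<bar>x t / c\<bar> \<le> \<bar>x t / l\<bar>" for t using l(1) by (simp add: frac_le)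
    then have "modular (\<lambda>t. x t / c) \<le> modular (\<lambda>t. x t / l)"
      using orlicz_space_measurable[OF x] by (intro modular_mono) auto
    then show False using l(2) c(2) by simp
  qed
qed

lemma orlicz_ideal:
  assumes shr: "modular_shrinks" and x: "x \<in> borel_measurable M" and y: "y \<in> E\<phi>"
    and le: "AE t in M. \<bar>x t\<bar> \<le> \<bar>y t\<bar>"
  shows "x \<in> E\<phi>" and "norm\<phi> x \<le> norm\<phi> y"
proof -
  have m: "modular (\<lambda>t. c * x t) \<le> modular (\<lambda>t. c * y t)" for c
    using x le by (intro modular_mono) (auto simp: abs_mult elim!: eventually_mono intro: mult_left_mono)
  show "x \<in> E\<phi>" using m y x unfolding orlicz_space_def by (auto intro: le_less_trans)
  show "norm\<phi> x \<le> norm\<phi> y"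
  proof (rule orlicz_norm_ge[OF shr y])
    fix l assume l: "0 < l" "modular (\<lambda>t. y t / l) \<le> 1"
    have "modular (\<lambda>t. x t / l) \<le> 1" using m[of "1 / l"] l(2) by simp
    then show "norm\<phi> x \<le> l" by (rule orlicz_norm_le[OF l(1)])
  qed
qed

lemma orlicz_scale:
  assumes shr: "modular_shrinks" and x: "x \<in> E\<phi>"
  shows orlicz_scale_mem: "(\<lambda>t. c * x t) \<in> E\<phi>"
    and orlicz_norm_scale: "norm\<phi> (\<lambda>t. c * x t) = \<bar>c\<bar> * norm\<phi> x"
proof -
  have mem: "(\<lambda>t. c * x t) \<in> E\<phi>" if x: "x \<in> E\<phi>" for c x
  proof -
    obtain k where k: "0 < k" "modular (\<lambda>t. k * x t) < \<infinity>" and [measurable]: "x \<in> borel_measurable M"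
      using x unfolding orlicz_space_def by auto
    have "modular (\<lambda>t. k / (\<bar>c\<bar> + 1) * (c * x t)) \<le> modular (\<lambda>t. k * x t)"
    proof (rule modular_mono)
      have "\<bar>k / (\<bar>c\<bar> + 1) * (c * x t)\<bar> \<le> \<bar>k * x t\<bar>" for t
      proof -
        have "\<bar>k / (\<bar>c\<bar> + 1) * (c * x t)\<bar> = \<bar>c\<bar> / (\<bar>c\<bar> + 1) * \<bar>k * x t\<bar>"
          by (simp add: abs_mult)
        also have "\<dots> \<le> 1 * \<bar>k * x t\<bar>" by (intro mult_right_mono) auto
        finally show ?thesis by simp
      qed
      then show "AE t in M. \<bar>k / (\<bar>c\<bar> + 1) * (c * x t)\<bar> \<le> \<bar>k * x t\<bar>" by simp
    qed measurable
    then show ?thesis using k unfolding orlicz_space_def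
      by (auto intro!: exI[of _ "k / (\<bar>c\<bar> + 1)"] intro: le_less_trans divide_pos_pos)
  qed
  have le: "norm\<phi> (\<lambda>t. c * x t) \<le> \<bar>c\<bar> * norm\<phi> x" if x: "x \<in> E\<phi>" and c: "c \<noteq> 0" for c x
  proof -
    have "norm\<phi> (\<lambda>t. c * x t) / \<bar>c\<bar> \<le> norm\<phi> x"
    proof (rule orlicz_norm_ge[OF shr x])
      fix l assume l: "0 < l" "modular (\<lambda>t. x t / l) \<le> 1"
      have "modular (\<lambda>t. c * x t / (\<bar>c\<bar> * l)) \<le> modular (\<lambda>t. x t / l)"
        using orlicz_space_measurable[OF x] c by (intro modular_mono) (auto simp: abs_mult)
      then have "norm\<phi> (\<lambda>t. c * x t) \<le> \<bar>c\<bar> * l" using l c by (intro orlicz_norm_le) auto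
      then show "norm\<phi> (\<lambda>t. c * x t) / \<bar>c\<bar> \<le> l" using c by (simp add: field_simps)
    qed
    then show ?thesis using c by (simp add: field_simps)
  qed
  show "(\<lambda>t. c * x t) \<in> E\<phi>" by (rule mem[OF x])
  show "norm\<phi> (\<lambda>t. c * x t) = \<bar>c\<bar> * norm\<phi> x"
  proof (cases "c = 0")
    case True
    have z: "modular (\<lambda>t. 0) \<le> ennreal (N (\<lambda>t. 0))"
      by (rule modular_le_of_dominated[OF _ zero_mem]) (auto simp: phi_zero)
    have "N (\<lambda>t. 0) = 0" using N_eq_0_iff[OF zero_mem] by simp
    then have "norm\<phi> (\<lambda>t. 0) \<le> l" if "0 < l" for l using that z by (intro orlicz_norm_le) auto
    then have "norm\<phi> (\<lambda>t. 0) \<le> 0" by (rule field_le_epsilon[of _ 0, simplified])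
    moreover have "0 \<le> norm\<phi> (\<lambda>t. 0)"
      using mem[OF x, of 0] by (intro orlicz_norm_ge[OF shr]) auto
    ultimately show ?thesis using True by simp
  next
    case False
    have "norm\<phi> (\<lambda>t. inverse c * (c * x t)) \<le> \<bar>inverse c\<bar> * norm\<phi> (\<lambda>t. c * x t)"
      by (rule le[OF mem[OF x]]) (use False in simp)
    moreover have "(\<lambda>t. inverse c * (c * x t)) = x" using False by (simp add: mult.assoc[symmetric])
    ultimately have "\<bar>c\<bar> * norm\<phi> x \<le> norm\<phi> (\<lambda>t. c * x t)" using False by (simp add: field_simps)
    then show ?thesis using le[OF x False] by simp
  qed
qed

lemma orlicz_ideal_functional:
  assumes "modular_shrinks"
  shows "ideal_functional M E\<phi> norm\<phi>"
  unfolding ideal_functional_def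
proof (intro conjI ballI allI impI)
  show "E\<phi> \<subseteq> borel_measurable M" using orlicz_space_measurable by blast
qed (use orlicz_scale[OF assms] orlicz_ideal[OF assms] in auto)

end

section \<open>Copies of \<open>l\<^sub>\<infinity>\<close> in \<open>E\<^sub>\<phi>\<close>\<close>

lemma disjoint_step_functions:
  fixes u :: "nat \<Rightarrow> real"
  assumes A: "disjoint_family A" and u: "\<And>n. 0 \<le> u n"
  shows step_sum_on: "t \<in> A n \<Longrightarrow> (\<Sum>n. u n * indicator (A n) t) = u n"
    and step_sum_off: "t \<notin> (\<Union>n. A n) \<Longrightarrow> (\<Sum>n. u n * indicator (A n) t) = 0"
    and "order_bounded_disjoint M (\<lambda>n t. u n * indicator (A n) t) (\<lambda>t. \<Sum>n. u n * indicator (A n) t)"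
proof -
  have disj: "indicator (A m) t = (0::real) \<or> indicator (A n) t = (0::real)" if "m \<noteq> n" for m n t
    using disjoint_family_onD[OF A _ _ that] by (auto simp: indicator_def)
  show on: "t \<in> A n \<Longrightarrow> (\<Sum>n. u n * indicator (A n) t) = u n" for n t
    using suminf_one_term[of "\<lambda>n. indicator (A n) t" n u] disj by simp
  show off: "t \<notin> (\<Union>n. A n) \<Longrightarrow> (\<Sum>n. u n * indicator (A n) t) = 0" for t
    by simp
  have le: "u n * indicator (A n) t \<le> (\<Sum>n. u n * indicator (A n) t)" for n t
  proof (cases "t \<in> (\<Union>n. A n)")
    case True
    then obtain k where k: "t \<in> A k" by blast
    show ?thesis
    proof (cases "n = k")
      case False
      then have "indicator (A n) t = (0::real)" using disj[of n k t] k by auto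
      then show ?thesis unfolding on[OF k] using u[of k] by simp
    qed (use k on[OF k] in simp)
  qed (use off in auto)
  show "order_bounded_disjoint M (\<lambda>n t. u n * indicator (A n) t) (\<lambda>t. \<Sum>n. u n * indicator (A n) t)"
    unfolding order_bounded_disjoint_def
  proof (intro AE_I2 conjI allI impI)
    show "0 \<le> u n * indicator (A n) t" for n t using u[of n] by simp
    show "u m * indicator (A m) t = 0 \<or> u n * indicator (A n) t = 0" if "m \<noteq> n" for m n t
      using disj[OF that, of t] by auto
  qed (rule le)
qed

context orlicz_setting
begin

text \<open>
  The criterion behind every copy in \<open>E\<^sub>\<phi>\<close>: it involves the modular only, because a modular above 1
  at \<open>X n / c\<close> keeps the quasi-norm of \<open>X n\<close> at or above \<open>c\<close>.
\<close>

lemma orlicz_copyI: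
  assumes shr: "modular_shrinks"
    and x: "x \<in> borel_measurable M" "0 < k" "modular (\<lambda>t. k * x t) < \<infinity>"
    and X: "\<And>n. X n \<in> borel_measurable M" "order_bounded_disjoint M X x"
    and c: "0 < c" "\<And>n. \<not> modular (\<lambda>t. X n t / c) \<le> 1"
  shows "contains_order_copy_l_infinity M E\<phi> norm\<phi>"
proof -
  have xm: "x \<in> E\<phi>" using x unfolding orlicz_space_def by blast
  have Xm: "X n \<in> E\<phi>" for n
  proof (rule orlicz_ideal(1)[OF shr X(1) xm])
    show "AE t in M. \<bar>X n t\<bar> \<le> \<bar>x t\<bar>"
      using X(2) unfolding order_bounded_disjoint_def
    proof eventually_elim
      case (elim t)
      then have "0 \<le> X n t" "X n t \<le> x t" by blast+
      then show ?case by simp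
    qed
  qed
  show ?thesis
    by (rule disjoint_sequence_imp_copy[OF orlicz_ideal_functional[OF shr] xm Xm X(2) c(1)])
      (rule orlicz_norm_ge_of_modular[OF shr Xm c])
qed

lemma step_copyI:
  fixes u :: "nat \<Rightarrow> real"
  assumes shr: "modular_shrinks"
    and A: "disjoint_family A" "\<And>n. A n \<in> sets M" and u: "\<And>n. 0 \<le> u n"
    and z: "z \<in> E" "0 < k" "\<And>n. AE t in M. t \<in> A n \<longrightarrow> \<phi> (k * u n) \<le> ennreal (z t)"
    and c: "0 < c" "\<And>n. \<not> modular (\<lambda>t. u n / c * indicator (A n) t) \<le> 1"
  shows "contains_order_copy_l_infinity M E\<phi> norm\<phi>"
proof (rule orlicz_copyI[OF shr _ z(2) _ _ disjoint_step_functions(3)[OF A(1) u] c(1)])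
  have X: "(\<lambda>t. u n * indicator (A n) t) \<in> borel_measurable M" for n
    using A(2) by measurable
  show "(\<lambda>t. u n * indicator (A n) t) \<in> borel_measurable M" for n by (rule X)
  show x: "(\<lambda>t. \<Sum>n. u n * indicator (A n) t) \<in> borel_measurable M"
    using X by measurable
  have "AE t in M. \<forall>n. t \<in> A n \<longrightarrow> \<phi> (k * u n) \<le> ennreal (z t)"
    using z(3) by (simp add: AE_all_countable)
  then have "AE t in M. \<phi> \<bar>k * (\<Sum>n. u n * indicator (A n) t)\<bar> \<le> ennreal (z t)"
  proof eventually_elim
    case (elim t)
    show ?case
    proof (cases "t \<in> (\<Union>n. A n)")
      case True
      then obtain n where n: "t \<in> A n" by blast
      show ?thesis unfolding step_sum_on[OF A(1) u n] using elim n z(2) u[of n] by simp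
    next
      case False
      show ?thesis unfolding step_sum_off[OF A(1) u False] by (simp add: phi_zero)
    qed
  qed
  moreover have "(\<lambda>t. k * (\<Sum>n. u n * indicator (A n) t)) \<in> borel_measurable M"
    using x by measurable
  ultimately have "modular (\<lambda>t. k * (\<Sum>n. u n * indicator (A n) t)) \<le> ennreal (N z)"
    by (intro modular_le_of_dominated[OF _ z(1)])
  then show "modular (\<lambda>t. k * (\<Sum>n. u n * indicator (A n) t)) < \<infinity>" by (auto intro: le_less_trans)
  show "\<not> modular (\<lambda>t. u n * indicator (A n) t / c) \<le> 1" for n using c(2)[of n] by simp
qed

lemma step_modular_le_1:
  assumes le: "modular (\<lambda>t. v * indicator A t) \<le> 1" and v: "0 \<le> v" and A: "A \<in> sets M"
  shows "emeasure M A \<noteq> 0 \<Longrightarrow> \<phi> v < top"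
    and "(indicator A :: 'a \<Rightarrow> real) \<in> E \<Longrightarrow> enn2real (\<phi> v) * N (indicator A) \<le> 1"
proof -
  have "modular (\<lambda>t. v * indicator A t) \<le> ennreal 1" using le by simp
  then obtain y where y: "AE t in M. \<phi> \<bar>v * indicator A t\<bar> = ennreal (y t)" "N y \<le> 1"
    "y = (\<lambda>t. enn2real (\<phi> \<bar>v * indicator A t\<bar>))"
    by (rule modular_leE[OF _ zero_le_one]) (rule that, assumption+)
  have "y = (\<lambda>t. enn2real (\<phi> v) * indicator A t)"
    unfolding y(3) using v by (auto simp: indicator_def phi_zero)
  then show "(indicator A :: 'a \<Rightarrow> real) \<in> E \<Longrightarrow> enn2real (\<phi> v) * N (indicator A) \<le> 1"
    using y(2) N_scale[of "indicator A" "enn2real (\<phi> v)"] by simp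
  show "\<phi> v < top" if "emeasure M A \<noteq> 0"
  proof (rule ccontr)
    assume "\<not> \<phi> v < top"
    then have inf: "\<phi> v = top" by (simp add: less_top[symmetric])
    have "AE t in M. t \<notin> A"
      using y(1)
    proof eventually_elim
      case (elim t)
      then show ?case using v inf by (cases "t \<in> A") auto
    qed
    then have "A \<in> null_sets M" using AE_iff_null_sets[OF A] by simp
    then show False using that by auto
  qed
qed

text \<open>
  The sequence is the jump point \<open>b\<close> of \<open>\<phi>\<close> on disjoint sets: \<open>\<phi>\<close> is finite at \<open>b / 2\<close> and
  infinite at \<open>2 * b\<close>.
\<close>

lemma copy_of_finite_threshold:
  assumes shr: "modular_shrinks" and na: "nonatomic M" and pos: "emeasure M (space M) > 0"
    and fin: "0 < u0" "\<phi> u0 < top" and inf: "0 \<le> u1" "\<phi> u1 = top"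
  shows "contains_order_copy_l_infinity M E\<phi> norm\<phi>"
proof -
  define S where "S = {u. 0 \<le> u \<and> \<phi> u < top}"
  define b where "b = Sup S"
  have bdd: "bdd_above S"
  proof (rule bdd_aboveI[of _ u1])
    fix u assume "u \<in> S"
    then show "u \<le> u1" using phi_mono[of u1 u] inf unfolding S_def by (cases "u \<le> u1") auto
  qed
  have S0: "u0 \<in> S" using fin unfolding S_def by simp
  have b: "0 < b" using cSup_upper[OF S0 bdd] fin unfolding b_def by simp
  have below: "\<phi> (1 / 2 * b) < top"
  proof -
    have "1 / 2 * b < Sup S" using b unfolding b_def by simp
    then obtain u where "u \<in> S" "1 / 2 * b < u" using less_cSup_iff[OF _ bdd] S0 by blast
    then show ?thesis using phi_mono[of "1 / 2 * b" u] b unfolding S_def by (auto intro: le_less_trans)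
  qed
  have above: "\<not> \<phi> (b / (1 / 2)) < top"
  proof
    assume "\<phi> (b / (1 / 2)) < top"
    then have "b / (1 / 2) \<in> S" using b unfolding S_def by simp
    then show False using cSup_upper[OF _ bdd] b unfolding b_def[symmetric] by fastforce
  qed
  obtain A where A: "A \<in> sets M" "(indicator A :: 'a \<Rightarrow> real) \<in> E" "emeasure M A \<noteq> 0"
    using positive_indicator_mem[OF pos] by blast
  obtain D :: "nat \<Rightarrow> 'a set" where D: "disjoint_family D"
    "\<And>n. D n \<in> sets M" "\<And>n. D n \<subseteq> A" "\<And>n. emeasure M (D n) \<noteq> 0"
    using nonatomic_disjoint_sequence[OF na A(1,3)] by blast
  show ?thesis
  proof (rule step_copyI[OF shr D(1,2), where u = "\<lambda>n. b" and k = "1 / 2" and c = "1 / 2"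
        and z = "\<lambda>t. enn2real (\<phi> (1 / 2 * b)) * indicator A t"])
    show "(\<lambda>t. enn2real (\<phi> (1 / 2 * b)) * indicator A t) \<in> E" by (rule scale_mem[OF A(2)])
    have "\<phi> (1 / 2 * b) \<le> ennreal (enn2real (\<phi> (1 / 2 * b)) * indicator A t)" if "t \<in> D n" for t n
    proof -
      have "t \<in> A" using that D(3) by blast
      then show ?thesis using ennreal_enn2real[OF below] by simp
    qed
    then show "AE t in M. t \<in> D n \<longrightarrow> \<phi> (1 / 2 * b) \<le> ennreal (enn2real (\<phi> (1 / 2 * b)) * indicator A t)" for n
      by (intro AE_I2) blast
    show "\<not> modular (\<lambda>t. b / (1 / 2) * indicator (D n) t) \<le> 1" for n
      using step_modular_le_1(1)[OF _ _ D(2)] D(4) above b by fastforce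
  qed (use b in auto)
qed

lemma enn2real_phi_continuous:
  assumes fin: "\<forall>u\<ge>0. \<phi> u < top"
  shows "continuous_on {0..} (\<lambda>u. enn2real (\<phi> u))"
proof -
  have "b_orlicz \<phi> = \<infinity>"
    unfolding b_orlicz_def
  proof (rule SUP_PInfty)
    fix n :: nat
    show "\<exists>u\<in>{u. 0 \<le> u \<and> \<phi> u < \<infinity>}. ereal (real n) \<le> ereal u"
      by (intro bexI[of _ "real n"]) (use fin in auto)
  qed
  then have "{u. 0 < u \<and> ereal u < b_orlicz \<phi>} = {0<..}" by auto
  then have cont: "continuous_on {0<..} \<phi>"
    using orlicz unfolding orlicz_function_def by simp
  have "(\<phi> \<longlongrightarrow> \<phi> u) (at u within {0..})" if "0 \<le> u" for u
  proof (cases "u = 0")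
    case True
    have "(\<phi> \<longlongrightarrow> \<phi> 0) (at_right 0)"
      using orlicz unfolding orlicz_function_def continuous_within by blast
    then show ?thesis using True by (simp add: at_within_Ici_at_right)
  next
    case False
    then have "isCont \<phi> u" using cont that by (simp add: continuous_on_eq_continuous_at)
    then show ?thesis unfolding continuous_within by (rule tendsto_within_subset) simp
  qed
  then have "((\<lambda>v. enn2real (\<phi> v)) \<longlongrightarrow> enn2real (\<phi> u)) (at u within {0..})" if "0 \<le> u" for u
    using that fin by (intro tendsto_enn2real) auto
  then show ?thesis unfolding continuous_on_def by simp
qed

lemma phi_attains:
  assumes fin: "\<forall>u\<ge>0. \<phi> u < top" and s: "0 \<le> s"
  obtains u where "0 \<le> u" "\<phi> u = ennreal s"
proof -
  obtain v where v: "0 < v" "ennreal s < \<phi> v" using phi_exceeds[of "ennreal s"] by auto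
  have "\<exists>u\<ge>0. u \<le> v \<and> enn2real (\<phi> u) = s"
  proof (rule IVT')
    show "enn2real (\<phi> 0) \<le> s" using s by (simp add: phi_zero)
    show "s \<le> enn2real (\<phi> v)"
    proof -
      have "ennreal s \<le> ennreal (enn2real (\<phi> v))" using v fin[rule_format, of v] by simp
      then show ?thesis by (simp add: ennreal_le_iff)
    qed
    show "continuous_on {0..v} (\<lambda>u. enn2real (\<phi> u))"
      by (rule continuous_on_subset[OF enn2real_phi_continuous[OF fin]]) auto
  qed (use v in simp)
  then obtain u where "0 \<le> u" "enn2real (\<phi> u) = s" by blast
  then show ?thesis using that fin[rule_format, of u] ennreal_enn2real[of "\<phi> u"] by simp
qed

text \<open>
  Any right inverse of a monotone function is itself monotone, hence measurable.  Its value at 0 is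
  set to 0, since \<open>\<phi>\<close> may vanish on a whole interval and disjointness of supports has to be kept.
\<close>

lemma phi_right_inverse:
  assumes fin: "\<forall>u\<ge>0. \<phi> u < top"
  obtains g :: "real \<Rightarrow> real" where "mono g" "g 0 = 0" "\<And>s. 0 \<le> s \<Longrightarrow> \<phi> (g s) = ennreal s" "\<And>s. 0 \<le> g s"
proof -
  have "\<exists>u. 0 \<le> u \<and> \<phi> u = ennreal s" if "0 \<le> s" for s
    by (rule phi_attains[OF fin that]) blast
  then obtain h where h: "\<And>s. 0 \<le> s \<Longrightarrow> 0 \<le> h s \<and> \<phi> (h s) = ennreal s" by metis
  define g where "g s = (if s \<le> 0 then 0 else h s)" for s
  have g: "0 \<le> g s" "0 \<le> s \<Longrightarrow> \<phi> (g s) = ennreal s" for s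
    using h[of s] unfolding g_def by (auto simp: phi_zero)
  show ?thesis
  proof (rule that[of g])
    show "mono g"
    proof (rule monoI)
      fix s s' :: real assume le: "s \<le> s'"
      show "g s \<le> g s'"
      proof (rule ccontr)
        assume not: "\<not> g s \<le> g s'"
        then have s: "0 < s" using g(1)[of s'] unfolding g_def by (auto split: if_splits)
        have "\<phi> (g s') \<le> \<phi> (g s)" using not g(1)[of s'] by (intro phi_mono) auto
        then have "s' \<le> s" using g(2)[of s] g(2)[of s'] s le by (simp add: ennreal_le_iff)
        then show False using le not by simp
      qed
    qed
  qed (use g in \<open>auto simp: g_def\<close>)
qed

text \<open>
  With \<open>g\<close> a right inverse of \<open>\<phi>\<close>, the functions \<open>g(X n)\<close> have modular \<open>N (X n) \<ge> c\<close>.  If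
  \<open>g(X n) / l\<close> had modular at most 1, shrinking by \<open>l\<close> would bring the modular of \<open>g(X n)\<close> down to
  \<open>c / 2\<close>.
\<close>

lemma copy_lifts:
  assumes shr: "modular_shrinks" and fin: "\<forall>u\<ge>0. \<phi> u < top"
    and copy: "contains_order_copy_l_infinity M E N"
  shows "contains_order_copy_l_infinity M E\<phi> norm\<phi>"
proof -
  obtain x X c where x: "x \<in> E" and X: "\<And>n. X n \<in> E" and ob: "order_bounded_disjoint M X x"
    and c: "0 < c" "\<And>n. c \<le> N (X n)"
    using copy_imp_disjoint_sequence[OF copy] by blast
  obtain g :: "real \<Rightarrow> real" where g: "mono g" "g 0 = 0" "\<And>s. 0 \<le> s \<Longrightarrow> \<phi> (g s) = ennreal s" "\<And>s. 0 \<le> g s"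
    using phi_right_inverse[OF fin] by blast
  have [measurable]: "g \<in> borel_measurable borel" by (rule borel_measurable_mono[OF g(1)])
  have m: "(\<lambda>t. g (y t)) \<in> borel_measurable M" if "y \<in> E" for y
    using measurable_of_mem[OF that] by measurable
  have X0: "AE t in M. 0 \<le> X n t" for n
    using ob unfolding order_bounded_disjoint_def by (auto elim: eventually_mono)
  have x0: "AE t in M. 0 \<le> x t"
    using ob unfolding order_bounded_disjoint_def by eventually_elim (meson order_trans)
  have "c / 2 > 0" using c by simp
  then obtain l where l: "0 < l" "\<forall>y\<in>borel_measurable M. modular y \<le> ennreal 1 \<longrightarrow>
      modular (\<lambda>t. l * y t) \<le> ennreal (c / 2)"
    using shr unfolding modular_shrinks_def by (metis zero_less_one)
  show ?thesis
  proof (rule orlicz_copyI[OF shr m[OF x] zero_less_one _ m[OF X] _ l(1)])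
    have "AE t in M. \<phi> \<bar>1 * g (x t)\<bar> \<le> ennreal (x t)"
      using x0 by eventually_elim (use g in simp)
    then have "modular (\<lambda>t. 1 * g (x t)) \<le> ennreal (N x)"
      using m[OF x] by (intro modular_le_of_dominated[OF _ x]) auto
    then show "modular (\<lambda>t. 1 * g (x t)) < \<infinity>" by (auto intro: le_less_trans)
    show "order_bounded_disjoint M (\<lambda>n t. g (X n t)) (\<lambda>t. g (x t))"
      using ob unfolding order_bounded_disjoint_def
    proof eventually_elim
      case (elim t)
      then have "g (X n t) \<le> g (x t)" for n using monoD[OF g(1)] by blast
      then show ?case using elim g(2,4) by metis
    qed
    show "\<not> modular (\<lambda>t. g (X n t) / l) \<le> 1" for n
    proof
      assume "modular (\<lambda>t. g (X n t) / l) \<le> 1"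
      moreover have "(\<lambda>t. g (X n t) / l) \<in> borel_measurable M" using m[OF X] by measurable
      ultimately have "modular (\<lambda>t. l * (g (X n t) / l)) \<le> ennreal (c / 2)"
        using l(2)[rule_format, of "\<lambda>t. g (X n t) / l"] by simp
      then have "modular (\<lambda>t. g (X n t)) \<le> ennreal (c / 2)" using l(1) by simp
      then obtain y where y: "y \<in> E" "\<And>t. 0 \<le> y t"
        "AE t in M. \<phi> \<bar>g (X n t)\<bar> = ennreal (y t)" "N y \<le> c / 2"
        by (rule modular_leE) (use c in auto)
      have "AE t in M. \<bar>X n t\<bar> \<le> \<bar>y t\<bar>"
        using y(3) X0[of n]
      proof eventually_elim
        case (elim t)
        then have "ennreal (X n t) = ennreal (y t)" using g(3)[of "X n t"] g(4)[of "X n t"] by simp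
        then show ?case using elim y(2)[of t] by simp
      qed
      then have "N (X n) \<le> N y" by (rule N_mono[OF measurable_of_mem[OF X] y(1)])
      then show False using y(4) c(1) c(2)[of n] by linarith
    qed
  qed
qed

text \<open>
  On \<open>A n\<close>, a subset of \<open>B n\<close>, the function \<open>\<phi>(u n)\<close> has norm between \<open>q n / modulus\<close> and \<open>q n\<close>.  The
  upper bound is summable in the sense of \<open>summable_norms_dominated\<close>, so all these functions lie below
  one \<open>z\<close>.  The lower bound, multiplied by the doubling factor \<open>2 * modulus / q n\<close>, shows that
  \<open>\<phi>(2 * u n)\<close> has norm at least 2 on \<open>A n\<close>.
\<close>

lemma copy_of_doubling_failure:
  fixes u :: "nat \<Rightarrow> real"
  assumes shr: "modular_shrinks" and na: "nonatomic M"
    and fin: "\<forall>u\<ge>0. \<phi> u < top"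
    and no_copy: "\<not> contains_order_copy_l_infinity M E N"
    and q: "q = (\<lambda>n. (1 / (2 * modulus)) ^ Suc n)"
    and B: "disjoint_family B" "\<And>n. B n \<in> sets M" "\<And>n. (indicator (B n) :: 'a \<Rightarrow> real) \<in> E"
    and u: "\<And>n. 0 \<le> u n" "\<And>n. \<not> \<phi> (2 * u n) \<le> ennreal (2 * modulus / q n) * \<phi> (u n)"
    and phi_u: "\<And>n. 0 < enn2real (\<phi> (u n))" "\<And>n. q n < enn2real (\<phi> (u n)) * N (indicator (B n))"
  shows "contains_order_copy_l_infinity M E\<phi> norm\<phi>"
proof -
  define f where "f v = enn2real (\<phi> v)" for v
  have f: "\<phi> v = ennreal (f v)" if "0 \<le> v" for v using fin[rule_format, OF that] unfolding f_def by simp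
  have fu: "0 < f (u n)" for n using phi_u(1) unfolding f_def .
  have q0: "0 < q n" for n using modulus_ge_1 unfolding q by simp
  have "\<exists>A\<in>sets M. A \<subseteq> B n \<and> N (indicator A) \<le> q n / f (u n) \<and>
      q n / f (u n) \<le> modulus * N (indicator A)" for n
  proof -
    have "q n / f (u n) < N (indicator (B n))"
      using phi_u(2)[of n] fu[of n] unfolding f_def by (simp add: field_simps)
    moreover have "0 \<le> q n / f (u n)" using q0 fu by (simp add: less_imp_le)
    ultimately show ?thesis
      using indicator_with_prescribed_norm[OF no_copy na B(2,3)[of n], of "q n / f (u n)"] by metis
  qed
  then obtain A where A: "\<And>n. A n \<in> sets M" "\<And>n. A n \<subseteq> B n"
    "\<And>n. N (indicator (A n)) \<le> q n / f (u n)" "\<And>n. q n / f (u n) \<le> modulus * N (indicator (A n))"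
    by metis
  have mem: "(indicator (A n) :: 'a \<Rightarrow> real) \<in> E" for n by (rule indicator_subset_mem[OF B(3) A(1,2)])
  have disj: "disjoint_family A"
    using B(1) A(2) unfolding disjoint_family_on_def by (meson disjoint_iff subsetD)
  have "\<And>n. (\<lambda>t. f (u n) * indicator (A n) t) \<in> E" by (rule scale_mem[OF mem])
  moreover have "N (\<lambda>t. f (u n) * indicator (A n) t) \<le> (1 / (2 * modulus)) ^ Suc n" for n
  proof -
    have "N (\<lambda>t. f (u n) * indicator (A n) t) = f (u n) * N (indicator (A n))"
      using N_scale[OF mem, of "f (u n)" n] fu[of n] by simp
    also have "\<dots> \<le> f (u n) * (q n / f (u n))" using A(3)[of n] fu[of n] by (intro mult_left_mono) auto
    also have "\<dots> = (1 / (2 * modulus)) ^ Suc n" using fu[of n] unfolding q by simp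
    finally show ?thesis .
  qed
  ultimately obtain z where z: "z \<in> E" "AE t in M. \<forall>n. \<bar>f (u n) * indicator (A n) t\<bar> \<le> z t"
    by (rule summable_norms_dominated) blast
  show ?thesis
  proof (rule step_copyI[OF shr disj A(1) u(1) z(1) zero_less_one, where c = "1 / 2"])
    show "AE t in M. t \<in> A n \<longrightarrow> \<phi> (1 * u n) \<le> ennreal (z t)" for n
      using z(2)
    proof eventually_elim
      case (elim t)
      show ?case
      proof
        assume t: "t \<in> A n"
        have "\<bar>f (u n) * indicator (A n) t\<bar> \<le> z t" using elim by blast
        then have "f (u n) \<le> z t" using t fu[of n] by simp
        then show "\<phi> (1 * u n) \<le> ennreal (z t)" using f[OF u(1)[of n]] by (simp add: ennreal_leI)
      qed
    qed
    show "\<not> modular (\<lambda>t. u n / (1 / 2) * indicator (A n) t) \<le> 1" for n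
    proof
      assume "modular (\<lambda>t. u n / (1 / 2) * indicator (A n) t) \<le> 1"
      then have le: "f (2 * u n) * N (indicator (A n)) \<le> 1"
        using step_modular_le_1(2)[of "u n / (1 / 2)" "A n"] u(1)[of n] A(1)[of n] mem[of n]
        unfolding f_def by (simp add: mult.commute)
      have "\<not> ennreal (f (2 * u n)) \<le> ennreal (2 * modulus / q n * f (u n))"
        using u(2)[of n] f[of "u n"] f[of "2 * u n"] u(1)[of n] modulus_ge_1 q0[of n]
        by (simp add: ennreal_mult'[symmetric])
      then have "2 * modulus / q n * f (u n) \<le> f (2 * u n)" by (meson ennreal_leI linear)
      then have "2 * modulus / q n * f (u n) * N (indicator (A n)) \<le> 1"
        using le N_nonneg[OF mem, of n] by (meson mult_right_mono order_trans)
      moreover have "2 \<le> 2 * modulus / q n * f (u n) * N (indicator (A n))"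
        using A(4)[of n] fu[of n] q0[of n] by (simp add: field_simps)
      ultimately show False by linarith
    qed
  qed simp
qed

text \<open>
  Here the sets \<open>B n\<close> are chosen first.  The failure of doubling occurs at arbitrarily large
  arguments, so \<open>\<phi>(u n)\<close> can be made large enough for the norm of \<open>B n\<close>.
\<close>

lemma not_Delta2_copy_at_infinity:
  assumes shr: "modular_shrinks" and na: "nonatomic M" and pos: "emeasure M (space M) > 0"
    and fin: "\<forall>u\<ge>0. \<phi> u < top"
    and no_copy: "\<not> contains_order_copy_l_infinity M E N"
    and LE: "L_infinity M \<subseteq> E" and nD: "\<not> Delta2 At_Infinity \<phi>"
  shows "contains_order_copy_l_infinity M E\<phi> norm\<phi>"
proof -
  define q where "q = (\<lambda>n. (1 / (2 * modulus)) ^ Suc n)"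
  have q0: "0 < q n" for n using modulus_ge_1 unfolding q_def by simp
  have mem: "(indicator A :: 'a \<Rightarrow> real) \<in> E" if "A \<in> sets M" for A
    by (rule ideal_mem[OF indicator_measurable[OF that] constant_mem[OF LE, of 1]]) simp
  obtain B :: "nat \<Rightarrow> 'a set" where B: "disjoint_family B" "\<And>n. B n \<in> sets M"
    "\<And>n. emeasure M (B n) \<noteq> 0"
    using nonatomic_disjoint_sequence[OF na sets.top] pos by (metis less_numeral_extra(3))
  have NB: "0 < N (indicator (B n))" for n
    using N_nonneg[OF mem[OF B(2)], of n] N_indicator_eq_0_iff[OF mem[OF B(2)] B(2), of n] B(3)[of n]
    by simp
  have "\<exists>u\<ge>0. \<not> \<phi> (2 * u) \<le> ennreal (2 * modulus / q n) * \<phi> u \<and>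
      q n / N (indicator (B n)) < enn2real (\<phi> u)" for n
  proof -
    obtain u0 where u0: "0 < u0" "ennreal (q n / N (indicator (B n))) < \<phi> u0"
      using phi_exceeds[of "ennreal (q n / N (indicator (B n)))"] by auto
    have "0 < 2 * modulus / q n" using q0 modulus_ge_1 by simp
    then obtain u where u: "u0 \<le> u" "\<not> \<phi> (2 * u) \<le> ennreal (2 * modulus / q n) * \<phi> u"
      using nD u0 fin[rule_format, of u0] unfolding Delta2_def by auto
    have "ennreal (q n / N (indicator (B n))) < \<phi> u"
      using u0 phi_mono[of u0 u] u by (auto intro: less_le_trans)
    then have "ennreal (q n / N (indicator (B n))) < ennreal (enn2real (\<phi> u))"
      using fin[rule_format, of u] u u0 by simp
    then have "q n / N (indicator (B n)) < enn2real (\<phi> u)"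
      using q0[of n] NB[of n] by (simp add: ennreal_less_iff)
    then show ?thesis using u u0 by (intro exI[of _ u]) auto
  qed
  then obtain u where u: "\<And>n. 0 \<le> u n" "\<And>n. \<not> \<phi> (2 * u n) \<le> ennreal (2 * modulus / q n) * \<phi> (u n)"
    "\<And>n. q n / N (indicator (B n)) < enn2real (\<phi> (u n))" by metis
  show ?thesis
  proof (rule copy_of_doubling_failure[OF shr na fin no_copy q_def B(1,2) mem[OF B(2)] u(1,2)])
    fix n
    have "0 < q n / N (indicator (B n))" using q0 NB by simp
    then show "0 < enn2real (\<phi> (u n))" using u(3)[of n] by linarith
    show "q n < enn2real (\<phi> (u n)) * N (indicator (B n))"
      using u(3)[of n] NB[of n] by (simp add: field_simps)
  qed
qed

text \<open>
  Here the points \<open>u n\<close> come first and may well tend to zero.  As the constant 1 is not in \<open>E\<close>, there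
  are disjoint sets \<open>B n\<close> of norm as large as these points require.  If doubling fails because
  \<open>\<phi> u = 0 < \<phi> (2 * u)\<close>, the constant \<open>u\<close> has modular zero on any set, and the step function
  \<open>u\<close> on sets of large norm serves directly.
\<close>

lemma not_Delta2_copy_everywhere:
  assumes shr: "modular_shrinks" and na: "nonatomic M"
    and fin: "\<forall>u\<ge>0. \<phi> u < top"
    and no_copy: "\<not> contains_order_copy_l_infinity M E N"
    and LE: "\<not> L_infinity M \<subseteq> E" and nD: "\<not> Delta2 Everywhere \<phi>"
  shows "contains_order_copy_l_infinity M E\<phi> norm\<phi>"
proof -
  have one: "(\<lambda>t. 1) \<notin> E"
  proof
    assume one: "(\<lambda>t. 1) \<in> E"
    have "x \<in> E" if x: "x \<in> L_infinity M" for x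
    proof -
      obtain C where C: "x \<in> borel_measurable M" "AE t in M. \<bar>x t\<bar> \<le> C"
        using x unfolding L_infinity_def by blast
      have "AE t in M. \<bar>x t\<bar> \<le> \<bar>C * 1\<bar>" using C(2) by eventually_elim simp
      then show ?thesis by (rule ideal_mem[OF C(1) scale_mem[OF one]])
    qed
    then show False using LE by blast
  qed
  show ?thesis
  proof (cases "\<exists>u\<ge>0. \<phi> u = 0 \<and> \<phi> (2 * u) \<noteq> 0")
    case True
    then obtain u where u: "0 \<le> u" "\<phi> u = 0" "\<phi> (2 * u) \<noteq> 0" by blast
    have f: "0 < enn2real (\<phi> (2 * u))"
      using u fin[rule_format, of "2 * u"] enn2real_eq_0_iff[of "\<phi> (2 * u)"] by (simp add: enn2real_positive_iff zero_less_iff_neq_zero)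
    obtain B where B: "disjoint_family B" "\<And>n. B n \<in> sets M"
      "\<And>n. (indicator (B n) :: 'a \<Rightarrow> real) \<in> E"
      "\<And>n::nat. 1 / enn2real (\<phi> (2 * u)) < N (indicator (B n))"
      using disjoint_indicators_of_large_norm[OF one, of "\<lambda>n. 1 / enn2real (\<phi> (2 * u))"] by blast
    show ?thesis
    proof (rule step_copyI[OF shr B(1,2) u(1) zero_mem zero_less_one, where c = "1 / 2"])
      show "AE t in M. t \<in> B n \<longrightarrow> \<phi> (1 * u) \<le> ennreal 0" for n using u by simp
      show "\<not> modular (\<lambda>t. u / (1 / 2) * indicator (B n) t) \<le> 1" for n
      proof
        assume "modular (\<lambda>t. u / (1 / 2) * indicator (B n) t) \<le> 1"
        then have "enn2real (\<phi> (2 * u)) * N (indicator (B n)) \<le> 1"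
          using step_modular_le_1(2)[of "u / (1 / 2)" "B n"] u(1) B(2,3)[of n]
          by (simp add: mult.commute)
        then show False using B(4)[of n] f by (simp add: field_simps)
      qed
    qed simp
  next
    case False
    define q where "q = (\<lambda>n. (1 / (2 * modulus)) ^ Suc n)"
    have q0: "0 < q n" for n using modulus_ge_1 unfolding q_def by simp
    have "\<exists>u\<ge>0. \<not> \<phi> (2 * u) \<le> ennreal (2 * modulus / q n) * \<phi> u" for n
    proof -
      have "0 < 2 * modulus / q n" using q0 modulus_ge_1 by simp
      then show ?thesis using nD unfolding Delta2_def by auto
    qed
    then obtain u where u: "\<And>n. 0 \<le> u n"
      "\<And>n. \<not> \<phi> (2 * u n) \<le> ennreal (2 * modulus / q n) * \<phi> (u n)" by metis
    have f: "0 < enn2real (\<phi> (u n))" for n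
    proof -
      have "\<phi> (u n) \<noteq> 0"
      proof
        assume z: "\<phi> (u n) = 0"
        then have "\<phi> (2 * u n) = 0" using False u(1)[of n] by blast
        then show False using u(2)[of n] by simp
      qed
      then show ?thesis using fin[rule_format, OF u(1)[of n]] by (simp add: enn2real_positive_iff zero_less_iff_neq_zero)
    qed
    obtain B where B: "disjoint_family B" "\<And>n. B n \<in> sets M"
      "\<And>n. (indicator (B n) :: 'a \<Rightarrow> real) \<in> E" "\<And>n. q n / enn2real (\<phi> (u n)) < N (indicator (B n))"
      using disjoint_indicators_of_large_norm[OF one, of "\<lambda>n. q n / enn2real (\<phi> (u n))"] by blast
    show ?thesis
    proof (rule copy_of_doubling_failure[OF shr na fin no_copy q_def B(1-3) u f])
      show "q n < enn2real (\<phi> (u n)) * N (indicator (B n))" for n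
        using B(4)[of n] f[of n] by (simp add: field_simps)
    qed
  qed
qed

lemma modular_double_finite:
  assumes w: "applicable M E w" "Delta2 w \<phi>" "w \<noteq> At_Zero"
    and x: "x \<in> borel_measurable M" "modular x < \<infinity>"
  shows "modular (\<lambda>t. 2 * x t) < \<infinity>"
proof -
  obtain y where y: "y \<in> E" "\<And>t. 0 \<le> y t" "AE t in M. \<phi> \<bar>x t\<bar> = ennreal (y t)"
    using modular_finiteE[OF x(2)] by blast
  \<comment> \<open>Both growth conditions amount to doubling up to an additive constant that belongs to \<open>E\<close>.\<close>
  have "\<exists>K d. 0 < K \<and> 0 \<le> d \<and> (\<lambda>t. d) \<in> E \<and> (\<forall>v\<ge>0. \<phi> (2 * v) \<le> ennreal K * \<phi> v + ennreal d)"
  proof (cases w)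
    case Everywhere
    then obtain K where "0 < K" "\<forall>u\<ge>0. \<phi> (2 * u) \<le> ennreal K * \<phi> u"
      using w(2) unfolding Delta2_def by auto
    then show ?thesis using zero_mem by (intro exI[of _ K] exI[of _ 0]) auto
  next
    case At_Infinity
    then obtain K u0 where K: "0 < K" "0 < u0" "\<phi> u0 < \<infinity>"
      "\<And>u. u0 \<le> u \<Longrightarrow> \<phi> (2 * u) \<le> ennreal K * \<phi> u"
      using w(2) unfolding Delta2_def by auto
    have LE: "L_infinity M \<subseteq> E" using w(1) At_Infinity by (simp add: applicable_def)
    define d where "d = enn2real (\<phi> (2 * u0))"
    have "\<phi> (2 * u0) < top"
      using K(4)[of u0] K(3) by (auto simp: ennreal_mult_less_top intro: le_less_trans)
    then have d: "\<phi> (2 * u0) = ennreal d" unfolding d_def by simp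
    have "\<phi> (2 * v) \<le> ennreal K * \<phi> v + ennreal d" if "0 \<le> v" for v
    proof (cases "u0 \<le> v")
      case True
      then show ?thesis using K(4)[OF True] by (simp add: add_increasing2)
    next
      case False
      then have "\<phi> (2 * v) \<le> \<phi> (2 * u0)" using that by (intro phi_mono) auto
      then show ?thesis unfolding d by (simp add: add_increasing)
    qed
    moreover have "0 \<le> d" unfolding d_def by simp
    ultimately show ?thesis using K(1) constant_mem[OF LE] by blast
  qed (use w(3) in simp)
  then obtain K d where K: "0 < K" "0 \<le> d" "(\<lambda>t. d) \<in> E"
    "\<And>v. 0 \<le> v \<Longrightarrow> \<phi> (2 * v) \<le> ennreal K * \<phi> v + ennreal d" by blast
  have "modular (\<lambda>t. 2 * x t) \<le> ennreal (N (\<lambda>t. K * y t + d))"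
  proof (rule modular_le_of_dominated[OF _ add_mem[OF scale_mem[OF y(1)] K(3)]])
    show "(\<lambda>t. 2 * x t) \<in> borel_measurable M" using x(1) by measurable
    show "AE t in M. \<phi> \<bar>2 * x t\<bar> \<le> ennreal (K * y t + d)"
      using y(3)
    proof eventually_elim
      case (elim t)
      have "\<phi> \<bar>2 * x t\<bar> \<le> ennreal K * \<phi> \<bar>x t\<bar> + ennreal d"
        using K(4)[of "\<bar>x t\<bar>"] by (simp add: abs_mult)
      also have "\<dots> = ennreal (K * y t + d)"
        unfolding elim using K(1,2) y(2)[of t] by (simp add: ennreal_mult' ennreal_plus)
      finally show ?case .
    qed
  qed
  then show ?thesis by (auto intro: le_less_trans)
qed

text \<open>
  Iterating the doubling condition makes the modular of every multiple of \<open>x\<close> finite.  With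
  \<open>d = c / 2\<close> the modular of \<open>X n / d\<close> exceeds 1, since otherwise the quasi-norm of \<open>X n\<close> would be at
  most \<open>d < c\<close>.
\<close>

lemma Delta2_copy_descends:
  assumes shr: "modular_shrinks"
    and w: "applicable M E w" "Delta2 w \<phi>" "w \<noteq> At_Zero"
    and copy: "contains_order_copy_l_infinity M E\<phi> norm\<phi>"
  shows "contains_order_copy_l_infinity M E N"
proof -
  obtain x X c where x: "x \<in> E\<phi>" and X: "\<And>n. X n \<in> E\<phi>" and ob: "order_bounded_disjoint M X x"
    and c: "0 < c" "\<And>n. c \<le> norm\<phi> (X n)"
    using copy_imp_disjoint_sequence[OF copy] by blast
  obtain k where k: "0 < k" "modular (\<lambda>t. k * x t) < \<infinity>" and xm: "x \<in> borel_measurable M"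
    using x unfolding orlicz_space_def by auto
  have pow: "modular (\<lambda>t. 2 ^ j * (k * x t)) < \<infinity>" for j
  proof (induction j)
    case (Suc j)
    have "(\<lambda>t. 2 ^ j * (k * x t)) \<in> borel_measurable M" using xm by measurable
    from modular_double_finite[OF w this Suc] show ?case by (simp add: mult.assoc)
  qed (use k in simp)
  define d where "d = c / 2"
  have d: "0 < d" "d < c" using c(1) unfolding d_def by auto
  obtain j where j: "1 / (d * k) < 2 ^ j" using real_arch_pow[of 2 "1 / (d * k)"] by auto
  have fin: "modular (\<lambda>t. x t / d) < \<infinity>"
  proof -
    have "1 / d \<le> 2 ^ j * k" using j d k by (simp add: field_simps)
    then have "\<bar>x t\<bar> * (1 / d) \<le> \<bar>x t\<bar> * (2 ^ j * k)" for t by (intro mult_left_mono) auto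
    then have "\<bar>x t / d\<bar> \<le> \<bar>2 ^ j * (k * x t)\<bar>" for t using d k by (simp add: abs_mult mult_ac)
    then have "modular (\<lambda>t. x t / d) \<le> modular (\<lambda>t. 2 ^ j * (k * x t))"
      using xm by (intro modular_mono) auto
    then show ?thesis using pow[of j] by (rule le_less_trans)
  qed
  define Y where "Y n = (\<lambda>t. enn2real (\<phi> \<bar>X n t / d\<bar>))" for n
  have Xm: "X n \<in> borel_measurable M" for n using orlicz_space_measurable[OF X] .
  obtain y where y: "y \<in> E" "\<And>t. 0 \<le> y t" "AE t in M. \<phi> \<bar>x t / d\<bar> = ennreal (y t)"
    using modular_finiteE[OF fin] by blast
  have le: "AE t in M. \<forall>n. \<phi> \<bar>X n t / d\<bar> \<le> ennreal (y t)"
    using y(3) ob unfolding order_bounded_disjoint_def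
  proof eventually_elim
    case (elim t)
    have "\<phi> \<bar>X n t / d\<bar> \<le> \<phi> \<bar>x t / d\<bar>" for n
    proof -
      have "0 \<le> X n t" "X n t \<le> x t" using elim by blast+
      then show ?thesis using d(1) by (intro phi_mono) (auto simp: divide_right_mono)
    qed
    then show ?case using elim by metis
  qed
  have mod_Y: "modular (\<lambda>t. X n t / d) < \<infinity> \<and> Y n \<in> E \<and> 1 < N (Y n)" for n
  proof -
    have "AE t in M. \<phi> \<bar>X n t / d\<bar> \<le> ennreal (y t)" using le by eventually_elim blast
    then have "modular (\<lambda>t. X n t / d) \<le> ennreal (N y)"
      using Xm[of n] by (intro modular_le_of_dominated[OF _ y(1)]) auto
    then have fin: "modular (\<lambda>t. X n t / d) < \<infinity>" by (auto intro: le_less_trans)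
    then obtain Z where Z: "Z \<in> E" "modular (\<lambda>t. X n t / d) = ennreal (N Z)"
      "Z = (\<lambda>t. enn2real (\<phi> \<bar>X n t / d\<bar>))"
      by (rule modular_finiteE) (rule that, assumption+)
    have "\<not> modular (\<lambda>t. X n t / d) \<le> 1"
      using orlicz_norm_le[OF d(1), of "X n"] c(2)[of n] d(2) by linarith
    then have "1 < N Z" unfolding Z(2) by simp
    then show ?thesis using fin Z unfolding Y_def by simp
  qed
  have Yy: "order_bounded_disjoint M Y y"
    unfolding order_bounded_disjoint_def
    using le ob unfolding order_bounded_disjoint_def
  proof eventually_elim
    case (elim t)
    have "Y n t \<le> y t" for n
      using elim(1) y(2)[of t] unfolding Y_def by (simp add: enn2real_leI)
    moreover have "Y n t = 0" if "X n t = 0" for n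
      using that unfolding Y_def by (simp add: phi_zero)
    moreover have "0 \<le> Y n t" for n unfolding Y_def by simp
    ultimately show ?case using elim(2) by blast
  qed
  show ?thesis
  proof (rule disjoint_sequence_imp_copy[OF ideal_functional y(1) _ Yy zero_less_one])
    show "Y n \<in> E" "1 \<le> N (Y n)" for n using mod_Y[of n] by simp_all
  qed
qed

end

section \<open>The characterisation\<close>

theorem corollary5p8:
  fixes M :: "'a measure"
    and E :: "('a \<Rightarrow> real) set"
    and N :: "('a \<Rightarrow> real) \<Rightarrow> real"
    and \<phi> :: "real \<Rightarrow> ennreal"
    and v w :: variant
  assumes "complete_measure M" and "sigma_finite_measure M" and "emeasure M (space M) > 0"
    and "nonatomic M"
    and "quasi_banach_ideal_space M E N" and "fatou_property M E N"
    and "orlicz_function \<phi>" and "a_orlicz \<phi> < b_orlicz \<phi>"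
    and "applicable M E v" and "lower_index v \<phi> > 0"
    and "applicable M E w"
  shows "contains_order_copy_l_infinity M (orlicz_space M E N \<phi>) (orlicz_norm M E N \<phi>) \<longleftrightarrow>
         contains_order_copy_l_infinity M E N \<or> \<not> Delta2 w \<phi>"
proof -
  interpret orlicz_setting M E N \<phi> by unfold_locales fact+
  note na = \<open>nonatomic M\<close> and pos = \<open>emeasure M (space M) > 0\<close>
  have shr: "modular_shrinks" by (rule positive_index_shrinks) fact+
  have zero: "w = At_Zero \<Longrightarrow> contains_order_copy_l_infinity M E N"
    using subspace_of_L_infinity_copy[OF na pos] \<open>applicable M E w\<close> by (simp add: applicable_def)
  obtain u0 where u0: "0 < u0" "\<phi> u0 < top"
  proof -
    have "ereal 0 \<le> a_orlicz \<phi>"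
      unfolding a_orlicz_def by (rule SUP_upper) (simp add: phi_zero)
    then have "ereal 0 < b_orlicz \<phi>" using \<open>a_orlicz \<phi> < b_orlicz \<phi>\<close> by (rule le_less_trans)
    then obtain u where "u \<in> {u. 0 \<le> u \<and> \<phi> u < \<infinity>}" "ereal 0 < ereal u"
      unfolding b_orlicz_def less_SUP_iff by blast
    then show ?thesis using that by simp
  qed
  have "contains_order_copy_l_infinity M E\<phi> norm\<phi>"
    if rhs: "contains_order_copy_l_infinity M E N \<or> \<not> Delta2 w \<phi>"
  proof (cases "\<exists>u\<ge>0. \<phi> u = top")
    case True
    then show ?thesis using copy_of_finite_threshold[OF shr na pos u0] by blast
  next
    case False
    then have fin: "\<forall>u\<ge>0. \<phi> u < top" by (simp add: less_top[symmetric])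
    show ?thesis
    proof (cases "contains_order_copy_l_infinity M E N")
      case True
      then show ?thesis by (rule copy_lifts[OF shr fin])
    next
      case no_copy: False
      then have nD: "\<not> Delta2 w \<phi>" using rhs by blast
      show ?thesis
      proof (cases w)
        case Everywhere
        then show ?thesis using not_Delta2_copy_everywhere[OF shr na fin no_copy] nD \<open>applicable M E w\<close>
          by (simp add: applicable_def)
      next
        case At_Infinity
        then show ?thesis using not_Delta2_copy_at_infinity[OF shr na pos fin no_copy] nD \<open>applicable M E w\<close>
          by (simp add: applicable_def)
      next
        case At_Zero
        then show ?thesis using zero no_copy by blast
      qed
    qed
  qed
  moreover have "contains_order_copy_l_infinity M E N"
    if "contains_order_copy_l_infinity M E\<phi> norm\<phi>" "Delta2 w \<phi>"
    using Delta2_copy_descends[OF shr \<open>applicable M E w\<close> that(2) _ that(1)] zero by blast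
  ultimately show ?thesis by blast
qed

end
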